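(* Let $(M,\rho)$ be a complete Riemannian manifold and let $A$ be a bounded subset of $M$. Put $R_A=\frac14\inf_{a\in A}\mathrm{inj}_aM$. Suppose there exists a constant $C_2(A)$ such that for every collection $\mathcal{F}$ of balls $B(x,r)$ with $x\in A$ and $0<r\leqslant R_A$, with $S$ denoting the set of centers of the balls in $\mathcal{F}$, there is a subcollection $\mathcal{F}'\subset\mathcal{F}$ with $$\chi_S\leqslant\sum_{B\in\mathcal{F}'}\chi_B\leqslant C_2(A).$$ Then there exists a constant $C_3(A)$ such that for every collection $\mathcal{F}$ of balls $B(x,r)$ with $x\in A$ and $0<r\leqslant R_A$, with $S$ denoting the set of centers of the balls in $\mathcal{F}$, there are $m\in\mathbb{N}$ with $m\leqslant C_3(A)$ and $m$ subcollections $\mathcal{F}_1,\dots,\mathcal{F}_m$ of $\mathcal{F}$, each consisting of pairwise disjoint balls, such that $$S\subset\bigcup_{i=1}^m\bigcup_{B\in\mathcal{F}_i}B.$$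
   Context: $\rho$ is the Riemannian distance on $M$ ($M$ connected). $B(x,r)=\{y\in M:\rho(x,y)\leqslant r\}$ is the closed metric ball with center $x$ and radius $r>0$; a ball is understood together with its center and radius. $\mathrm{inj}_xM$ is the injectivity radius of $M$ at $x$. $\chi_E$ denotes the characteristic function of a set $E$. *)

theory Defs
  imports "HOL-Analysis.Analysis"
begin

fun Ck_on :: "nat \<Rightarrow> 'e::real_normed_vector set \<Rightarrow> ('e \<Rightarrow> 'f::real_normed_vector) \<Rightarrow> bool"
  where
    "Ck_on 0 S f \<longleftrightarrow> continuous_on S f"
  | "Ck_on (Suc k) S f \<longleftrightarrow>
       (\<forall>x\<in>S. f differentiable (at x)) \<and>
       (\<forall>v. Ck_on k S (\<lambda>x. frechet_derivative f (at x) v))"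

text \<open>Only meant for open \<open>S\<close>; derivatives are taken in the ambient space.\<close>

definition smooth_on :: "'e::real_normed_vector set \<Rightarrow> ('e \<Rightarrow> 'f::real_normed_vector) \<Rightarrow> bool"
  where "smooth_on S f \<longleftrightarrow> (\<forall>k. Ck_on k S f)"

type_synonym ('a, 'e) chart = "'a set \<times> ('a \<Rightarrow> 'e)"

abbreviation chart_dom :: "('a, 'e) chart \<Rightarrow> 'a set"
  where "chart_dom c \<equiv> fst c"

abbreviation chart_map :: "('a, 'e) chart \<Rightarrow> 'a \<Rightarrow> 'e"
  where "chart_map c \<equiv> snd c"

abbreviation chart_ran :: "('a, 'e) chart \<Rightarrow> 'e set"
  where "chart_ran c \<equiv> chart_map c ` chart_dom c"

abbreviation chart_inv :: "('a, 'e) chart \<Rightarrow> 'e \<Rightarrow> 'a"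
  where "chart_inv c \<equiv> inv_into (chart_dom c) (chart_map c)"

abbreviation transition :: "('a, 'e) chart \<Rightarrow> ('a, 'e) chart \<Rightarrow> 'e \<Rightarrow> 'e"
  where "transition c d \<equiv> chart_map d \<circ> chart_inv c"

text \<open>
  The manifold is the whole type \<open>'a\<close>, and its dimension is \<open>DIM('e)\<close>. The atlas need not be
  maximal. A Riemannian metric is given by its local expressions: \<open>g c q v w\<close> is the inner
  product of the tangent vectors with components \<open>v\<close> and \<open>w\<close> in the chart \<open>c\<close>, at the point
  with coordinates \<open>q\<close> in that chart.
\<close>

type_synonym ('a, 'e) local_metric = "('a, 'e) chart \<Rightarrow> 'e \<Rightarrow> 'e \<Rightarrow> 'e \<Rightarrow> real"

locale riemannian_manifold =
  fixes atlas :: "('a::{t2_space, second_countable_topology}, 'e::euclidean_space) chart set"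
    and g :: "('a, 'e) local_metric"
  assumes chart_open: "c \<in> atlas \<Longrightarrow> open (chart_dom c) \<and> open (chart_ran c)"
    and chart_homeomorphism:
      "c \<in> atlas \<Longrightarrow> homeomorphism (chart_dom c) (chart_ran c) (chart_map c) (chart_inv c)"
    and charts_cover: "(\<Union>c\<in>atlas. chart_dom c) = UNIV"
    and transition_smooth:
      "c \<in> atlas \<Longrightarrow> d \<in> atlas \<Longrightarrow>
        smooth_on (chart_map c ` (chart_dom c \<inter> chart_dom d)) (transition c d)"
    and metric_bilinear: "c \<in> atlas \<Longrightarrow> q \<in> chart_ran c \<Longrightarrow> bilinear (g c q)"
    and metric_sym: "c \<in> atlas \<Longrightarrow> q \<in> chart_ran c \<Longrightarrow> g c q v w = g c q w v"
    and metric_pos: "c \<in> atlas \<Longrightarrow> q \<in> chart_ran c \<Longrightarrow> v \<noteq> 0 \<Longrightarrow> g c q v v > 0"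
    and metric_smooth: "c \<in> atlas \<Longrightarrow> smooth_on (chart_ran c) (\<lambda>q. g c q v w)"
    and metric_transform:
      "c \<in> atlas \<Longrightarrow> d \<in> atlas \<Longrightarrow> q \<in> chart_map c ` (chart_dom c \<inter> chart_dom d) \<Longrightarrow>
        g c q v w =
          g d (transition c d q)
            (frechet_derivative (transition c d) (at q) v)
            (frechet_derivative (transition c d) (at q) w)"

context
  fixes atlas :: "('a::topological_space, 'e::euclidean_space) chart set"
    and g :: "('a, 'e) local_metric"
begin

text \<open>One-sided derivatives are used at \<open>a\<close> and \<open>b\<close>.\<close>

definition C1_curve :: "(real \<Rightarrow> 'a) \<Rightarrow> real \<Rightarrow> real \<Rightarrow> bool"
  where "C1_curve \<gamma> a b \<longleftrightarrow>
    a < b \<and> continuous_on {a..b} \<gamma> \<and>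
    (\<forall>c\<in>atlas. \<exists>D.
      continuous_on {t\<in>{a..b}. \<gamma> t \<in> chart_dom c} D \<and>
      (\<forall>t\<in>{a..b}. \<gamma> t \<in> chart_dom c \<longrightarrow>
        ((chart_map c \<circ> \<gamma>) has_vector_derivative D t) (at t within {a..b})))"

inductive piecewise_C1_curve :: "(real \<Rightarrow> 'a) \<Rightarrow> real \<Rightarrow> real \<Rightarrow> bool" for \<gamma>
  where
    C1: "C1_curve \<gamma> a b \<Longrightarrow> piecewise_C1_curve \<gamma> a b"
  | join: "piecewise_C1_curve \<gamma> a b \<Longrightarrow> C1_curve \<gamma> b c \<Longrightarrow> piecewise_C1_curve \<gamma> a c"

text \<open>
  By the transformation law of the metric, the value does not depend on the chosen chart.
\<close>

definition speed :: "(real \<Rightarrow> 'a) \<Rightarrow> real \<Rightarrow> real"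
  where "speed \<gamma> t =
    (let c = (SOME c. c \<in> atlas \<and> \<gamma> t \<in> chart_dom c);
         v = vector_derivative (chart_map c \<circ> \<gamma>) (at t)
     in sqrt (g c (chart_map c (\<gamma> t)) v v))"

definition curve_length :: "(real \<Rightarrow> 'a) \<Rightarrow> real \<Rightarrow> real \<Rightarrow> real"
  where "curve_length \<gamma> a b = integral {a..b} (speed \<gamma>)"

definition riemannian_dist :: "'a \<Rightarrow> 'a \<Rightarrow> real"
  where "riemannian_dist x y =
    Inf {curve_length \<gamma> a b |\<gamma> a b. piecewise_C1_curve \<gamma> a b \<and> \<gamma> a = x \<and> \<gamma> b = y}"

text \<open>
  \<open>christoffel c q u v\<close> has the components \<open>\<Gamma>\<^sup>k\<^sub>i\<^sub>j u\<^sup>i v\<^sup>j\<close> for the Christoffel symbols \<open>\<Gamma>\<close> of the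
  Levi-Civita connection in the chart \<open>c\<close>.
\<close>

definition christoffel :: "('a, 'e) chart \<Rightarrow> 'e \<Rightarrow> 'e \<Rightarrow> 'e \<Rightarrow> 'e"
  where "christoffel c q u v =
    (THE z. \<forall>w. g c q z w =
      (frechet_derivative (\<lambda>p. g c p v w) (at q) u
       + frechet_derivative (\<lambda>p. g c p u w) (at q) v
       - frechet_derivative (\<lambda>p. g c p u v) (at q) w) / 2)"

text \<open>Only meant for open \<open>J\<close>.\<close>

definition geodesic_on :: "real set \<Rightarrow> (real \<Rightarrow> 'a) \<Rightarrow> bool"
  where "geodesic_on J \<gamma> \<longleftrightarrow>
    continuous_on J \<gamma> \<and>
    (\<forall>c\<in>atlas. \<exists>D. \<forall>t\<in>J. \<gamma> t \<in> chart_dom c \<longrightarrow>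
      ((chart_map c \<circ> \<gamma>) has_vector_derivative D t) (at t) \<and>
      (D has_vector_derivative - christoffel c (chart_map c (\<gamma> t)) (D t) (D t)) (at t))"

text \<open>
  The tangent space at \<open>x\<close> is identified with \<open>'e\<close> through a chart \<open>c\<close> around \<open>x\<close>.
\<close>

definition exp_map :: "('a, 'e) chart \<Rightarrow> 'a \<Rightarrow> 'e \<Rightarrow> 'a"
  where "exp_map c x v =
    (THE y. \<exists>\<gamma> J. open J \<and> is_interval J \<and> {0..1} \<subseteq> J \<and> geodesic_on J \<gamma> \<and>
      \<gamma> 0 = x \<and> ((chart_map c \<circ> \<gamma>) has_vector_derivative v) (at 0) \<and> y = \<gamma> 1)"

definition tangent_ball :: "('a, 'e) chart \<Rightarrow> 'a \<Rightarrow> real \<Rightarrow> 'e set"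
  where "tangent_ball c x r = {v. sqrt (g c (chart_map c x) v v) < r}"

definition diffeo_onto_image :: "'e set \<Rightarrow> ('e \<Rightarrow> 'a) \<Rightarrow> bool"
  where "diffeo_onto_image B E \<longleftrightarrow>
    inj_on E B \<and> continuous_on B E \<and> open (E ` B) \<and>
    (\<forall>d\<in>atlas.
      smooth_on {v\<in>B. E v \<in> chart_dom d} (chart_map d \<circ> E) \<and>
      smooth_on (chart_map d ` (chart_dom d \<inter> E ` B)) (inv_into B E \<circ> chart_inv d))"

text \<open>
  The exponential map is assumed to be defined on the whole tangent space, so this is the
  injectivity radius for complete manifolds.
\<close>

definition inj_radius :: "'a \<Rightarrow> ennreal"
  where "inj_radius x =
    Sup {ennreal r |r. r > 0 \<and>
      (\<exists>c\<in>atlas. x \<in> chart_dom c \<and> diffeo_onto_image (tangent_ball c x r) (exp_map c x))}"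

definition cover_radius :: "'a set \<Rightarrow> ennreal"
  where "cover_radius A = (INF a\<in>A. inj_radius a) / 4"

definition rball :: "'a \<Rightarrow> real \<Rightarrow> 'a set"
  where "rball x r = Metric_space.mcball UNIV riemannian_dist x r"

text \<open>A ball is represented by its center and radius.\<close>

definition ball_collection :: "'a set \<Rightarrow> ('a \<times> real) set \<Rightarrow> bool"
  where "ball_collection A F \<longleftrightarrow>
    (\<forall>(x, r)\<in>F. x \<in> A \<and> 0 < r \<and> ennreal r \<le> cover_radius A)"

end

end

theory Submission
  imports Defs
begin

text \<open>
  The Riemannian distance is a complete length metric which is locally bi-Lipschitz to a Euclidean
  space. By the Hopf--Rinow argument bounded sets are totally bounded, so near a bounded set \<open>A\<close>
  balls of radius \<open>2 r\<close> are covered by \<open>N\<close> balls of radius \<open>r / 4\<close>, with \<open>N\<close> independent of small \<open>r\<close>.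
  Take the subfamily with overlap at most \<open>K\<close>. If one of its balls \<open>B(y, s)\<close> with \<open>s \<ge> r\<close> meets \<open>B(x, r)\<close>,
  then an almost shortest curve from \<open>y\<close> to a common point passes a point of \<open>B(x, 2 r)\<close> whose
  \<open>r / 4\<close>-neighbourhood lies in \<open>B(y, s)\<close>. Hence \<open>B(y, s)\<close> contains one of the \<open>N\<close> net points, and there
  are at most \<open>N K\<close> such balls. Balls that are not small contain a point of a fixed finite net of \<open>A\<close>.
  A greedy colouring in order of decreasing radius then needs a bounded number of colours.
\<close>

section \<open>Colouring by decreasing radius and disjoint families in length spaces\<close>

text \<open>A ball may meet arbitrarily many much smaller balls, so the number of all neighbours has
  no bound; only neighbours of at least equal radius can be counted, and this dictates the order of
  the colouring. The family may be infinite with radii tending to 0. The order is still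
  well-founded, because the overlap bound and a finite net of \<open>A\<close> leave only finitely
  many balls above any positive radius. A common point of \<open>B(x, r)\<close> and
  \<open>B(y, s)\<close> may lie on the boundary of \<open>B(y, s)\<close>, and a net point close to
  it can then miss that ball. Moving back towards \<open>y\<close> by more than the net width
  creates the necessary room; this is where the length structure enters the counting. On the
  manifold the obstacle is the lower bound for the distance: a curve between two points of a chart
  may leave the chart. It is overcome by a truncated coordinate distance that is defined on the
  whole manifold.\<close>

lemma bounded_degree_colouring:
  fixes V :: "'v set" and rad :: "'v \<Rightarrow> real" and E :: "'v \<Rightarrow> 'v \<Rightarrow> bool"
  assumes fin: "\<And>v. v \<in> V \<Longrightarrow> finite {w\<in>V. rad v \<le> rad w}"
    and deg: "\<And>v. v \<in> V \<Longrightarrow> card {w\<in>V. rad v \<le> rad w \<and> E w v} \<le> D"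
    and sym: "\<And>u v. E u v \<Longrightarrow> E v u"
  shows "\<exists>col::'v \<Rightarrow> nat. (\<forall>v\<in>V. col v \<le> D) \<and>
    (\<forall>u\<in>V. \<forall>v\<in>V. u \<noteq> v \<longrightarrow> E u v \<longrightarrow> col u \<noteq> col v)"
proof -
  obtain W :: "'v rel" where W: "Well_order W \<and> Field W = UNIV"
    using well_ordering ..
  then have W: "well_order_on UNIV W" by auto
  define W' where "W' = W - Id"
  have wfW: "wf W'" using W unfolding W'_def well_order_on_def by simp
  have "total_on UNIV W" using W unfolding well_order_on_def linear_order_on_def by simp
  then have totW: "(x, y) \<in> W' \<or> (y, x) \<in> W'" if "x \<noteq> y" for x y
    using that unfolding W'_def total_on_def by simp
  \<comment> \<open>The rank: within \<open>V\<close>, a strictly larger radius gives a strictly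
    smaller count, and counts are natural numbers, so the order is well-founded even for infinite
    \<open>V\<close>. Equal ranks are separated by the well-order \<open>W'\<close>.\<close>
  define f where "f v = card {w\<in>V. rad v \<le> rad w}" for v
  define R where "R = inv_image (less_than <*lex*> W') (\<lambda>v. (f v, v))"
  have wfR: "wf R" unfolding R_def by (rule wf_inv_image[OF wf_lex_prod[OF wf_less_than wfW]])
  have totR: "(u, v) \<in> R \<or> (v, u) \<in> R" if "u \<noteq> v" for u v
    using totW[OF that] by (cases "f u" "f v" rule: linorder_cases) (auto simp: R_def)
  have R_rad: "rad v \<le> rad u" if "(u, v) \<in> R" "u \<in> V" "v \<in> V" for u v
  proof (rule ccontr)
    assume "\<not> rad v \<le> rad u"
    then have "{w\<in>V. rad v \<le> rad w} \<subset> {w\<in>V. rad u \<le> rad w}"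
      using \<open>u \<in> V\<close> by auto
    then have "f v < f u" unfolding f_def by (rule psubset_card_mono[OF fin[OF \<open>u \<in> V\<close>]])
    with that(1) show False by (simp add: R_def)
  qed
  \<comment> \<open>The neighbours coloured before \<open>v\<close>. They all have radius at least
    \<open>rad v\<close>, so there are at most \<open>D\<close> of them and one of the
    \<open>D + 1\<close> colours up to \<open>D\<close> is free.\<close>
  define N where "N v = {u\<in>V. (u, v) \<in> R \<and> E u v}" for v
  define F :: "('v \<Rightarrow> nat) \<Rightarrow> 'v \<Rightarrow> nat" where "F = (\<lambda>h v. LEAST c. c \<notin> h ` N v)"
  define col where "col = wfrec R F"
  have col: "col v = (LEAST c. c \<notin> col ` N v)" for v
  proof -
    have "cut col R v ` N v = col ` N v"
      by (rule image_cong) (auto simp: N_def cut_def)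
    then show ?thesis
      unfolding col_def by (subst wfrec[OF wfR]) (simp add: F_def)
  qed
  have N: "finite (N v)" "card (N v) \<le> D" if v: "v \<in> V" for v
  proof -
    have sub: "N v \<subseteq> {w\<in>V. rad v \<le> rad w \<and> E w v}"
      using R_rad v by (auto simp: N_def)
    have fin': "finite {w\<in>V. rad v \<le> rad w \<and> E w v}"
      by (rule finite_subset[OF _ fin[OF v]]) auto
    show "finite (N v)" using sub fin' by (rule finite_subset)
    show "card (N v) \<le> D" using card_mono[OF fin' sub] deg[OF v] by simp
  qed
  have colN: "col v \<notin> col ` N v" "col v \<le> D" if v: "v \<in> V" for v
  proof -
    have "\<not> {..D} \<subseteq> col ` N v"
    proof
      assume "{..D} \<subseteq> col ` N v"
      then have "card {..D} \<le> card (col ` N v)" by (intro card_mono finite_imageI N v)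
      also have "\<dots> \<le> D" using le_trans[OF card_image_le[OF N(1)[OF v]] N(2)[OF v]] .
      finally show False by simp
    qed
    then obtain c where c: "c \<le> D" "c \<notin> col ` N v" by auto
    show "col v \<notin> col ` N v" by (subst col) (rule LeastI, rule c(2))
    have "col v \<le> c" by (subst col) (rule Least_le, rule c(2))
    then show "col v \<le> D" using c(1) by simp
  qed
  have "col u \<noteq> col v" if "u \<in> V" "v \<in> V" "u \<noteq> v" "E u v" for u v
    using totR[OF that(3)]
  proof
    assume "(u, v) \<in> R"
    then have "u \<in> N v" using that by (simp add: N_def)
    then show ?thesis using colN(1)[OF that(2)] by (metis imageI)
  next
    assume "(v, u) \<in> R"
    then have "v \<in> N u" using that sym by (simp add: N_def)
    then show ?thesis using colN(1)[OF that(1)] by (metis imageI)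
  qed
  then show ?thesis using colN(2) by (intro exI[of _ col]) simp
qed

text \<open>Approximate intermediate points: the distance is an infimum that need not be attained,
  so a point splitting \<open>s + t\<close> is demanded only if \<open>d x y\<close> is strictly
  smaller.\<close>

locale length_space = Metric_space "UNIV" d for d :: "'a \<Rightarrow> 'a \<Rightarrow> real" +
  assumes between: "0 < s \<Longrightarrow> 0 < t \<Longrightarrow> d x y < s + t \<Longrightarrow> \<exists>z. d x z \<le> s \<and> d z y \<le> t"
begin

text \<open>\<open>N\<close> depends on \<open>U\<close> and \<open>k\<close> but not on
  \<open>r\<close>; this scale invariance is the point. Intersecting with \<open>U\<close> keeps the
  condition local, and the centres in \<open>P\<close> may lie outside \<open>U\<close>.\<close>

definition doubling :: "'a set \<Rightarrow> bool" where
  "doubling U \<longleftrightarrow> (\<forall>k>0. \<exists>N. \<forall>x\<in>U. \<forall>r>0. \<exists>P. finite P \<and> card P \<le> N \<and>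
     U \<inter> mcball x (k * r) \<subseteq> (\<Union>p\<in>P. mcball p r))"

text \<open>Total boundedness asks for centres in \<open>S\<close> and open balls. Each centre whose
  ball meets \<open>S\<close> is replaced by a point of \<open>S\<close> in that ball, which at most
  doubles the radius \<open>\<epsilon> / 3\<close>.\<close>

lemma mtotally_bounded_net:
  assumes "\<And>\<epsilon>. \<epsilon> > 0 \<Longrightarrow> \<exists>K. finite K \<and> S \<subseteq> (\<Union>x\<in>K. mcball x \<epsilon>)"
  shows "mtotally_bounded S"
  unfolding mtotally_bounded_def
proof (intro allI impI)
  fix \<epsilon> :: real assume "\<epsilon> > 0"
  then obtain K where K: "finite K" "S \<subseteq> (\<Union>x\<in>K. mcball x (\<epsilon> / 3))"
    using assms[of "\<epsilon> / 3"] by auto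
  define K' where "K' = {x\<in>K. S \<inter> mcball x (\<epsilon> / 3) \<noteq> {}}"
  define h where "h x = (SOME y. y \<in> S \<inter> mcball x (\<epsilon> / 3))" for x
  have h: "h x \<in> S" "d x (h x) \<le> \<epsilon> / 3" if "x \<in> K'" for x
  proof -
    have "S \<inter> mcball x (\<epsilon> / 3) \<noteq> {}" using that by (simp add: K'_def)
    then obtain y where "y \<in> S \<inter> mcball x (\<epsilon> / 3)" by (meson equals0I)
    then have "h x \<in> S \<inter> mcball x (\<epsilon> / 3)" unfolding h_def by (rule someI)
    then show "h x \<in> S" "d x (h x) \<le> \<epsilon> / 3" by auto
  qed
  have "S \<subseteq> (\<Union>x\<in>h ` K'. mball x \<epsilon>)"
  proof
    fix y assume y: "y \<in> S"
    then obtain x where x: "x \<in> K" "d x y \<le> \<epsilon> / 3" using K(2) by auto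
    then have "x \<in> K'" using y by (auto simp: K'_def)
    moreover have "d (h x) y < \<epsilon>"
      using triangle[of "h x" x y] h(2)[OF \<open>x \<in> K'\<close>] x(2) commute[of x "h x"] \<open>\<epsilon> > 0\<close> by simp
    ultimately show "y \<in> (\<Union>x\<in>h ` K'. mball x \<epsilon>)" by auto
  qed
  then show "\<exists>K. finite K \<and> K \<subseteq> S \<and> S \<subseteq> (\<Union>x\<in>K. mball x \<epsilon>)"
    using h(1) K(1) by (intro exI[of _ "h ` K'"]) (auto simp: K'_def)
qed

text \<open>A single application with \<open>k = R / \<epsilon>\<close> at scale
  \<open>\<epsilon>\<close> about the centre, since \<open>k * \<epsilon> = R\<close>.\<close>

lemma doubling_imp_mtotally_bounded:
  assumes "doubling (mball x R)"
  shows "mtotally_bounded (mball x R)"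
proof (cases "R > 0")
  case True
  show ?thesis
  proof (rule mtotally_bounded_net)
    fix \<epsilon> :: real assume \<epsilon>: "\<epsilon> > 0"
    then have "0 < R / \<epsilon>" using True by simp
    then obtain N where "\<forall>x'\<in>mball x R. \<forall>r>0. \<exists>P. finite P \<and> card P \<le> N \<and>
        mball x R \<inter> mcball x' (R / \<epsilon> * r) \<subseteq> (\<Union>p\<in>P. mcball p r)"
      using assms unfolding doubling_def by meson
    moreover have "x \<in> mball x R" using True by simp
    ultimately obtain P where P: "finite P" "mball x R \<inter> mcball x (R / \<epsilon> * \<epsilon>) \<subseteq> (\<Union>p\<in>P. mcball p \<epsilon>)"
      using \<epsilon> by meson
    have "mball x R \<subseteq> mcball x (R / \<epsilon> * \<epsilon>)" using \<epsilon> by auto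
    then show "\<exists>K. finite K \<and> mball x R \<subseteq> (\<Union>x\<in>K. mcball x \<epsilon>)"
      using P by blast
  qed
next
  case False
  then have "mball x R = {}" by (metis mball_eq_empty not_less)
  then show ?thesis by simp
qed

end

section \<open>Bounded sets in complete, locally doubling length spaces\<close>

locale locally_doubling_space = length_space +
  assumes locally_doubling: "\<exists>R>0. doubling (mball x R)"
    and mcomplete: mcomplete
begin

text \<open>Completeness makes the closure of a totally bounded set compact, so finitely many balls
  suffice. The factor 2 is a margin: everything within \<open>R p\<close> of a point of
  \<open>mball p (R p)\<close> still lies in the doubling ball.\<close>

lemma finite_doubling_cover:
  assumes "mtotally_bounded S"
  obtains I R where "finite I" "\<And>p. p \<in> I \<Longrightarrow> 0 < R p \<and> doubling (mball p (2 * R p))"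
    "S \<subseteq> (\<Union>p\<in>I. mball p (R p))"
proof -
  have "\<forall>x. \<exists>R. R > 0 \<and> doubling (mball x (2 * R))"
  proof
    fix x
    obtain R where "R > 0" "doubling (mball x R)" using locally_doubling by blast
    then show "\<exists>R. R > 0 \<and> doubling (mball x (2 * R))" by (intro exI[of _ "R/2"]) simp
  qed
  then obtain R where R: "\<And>x. R x > 0 \<and> doubling (mball x (2 * R x))" by metis
  have "compactin mtopology (mtopology closure_of S)"
    using assms mtotally_bounded_eq_compact_closure_of mcomplete by blast
  moreover have "\<And>U. U \<in> range (\<lambda>x. mball x (R x)) \<Longrightarrow> openin mtopology U" by auto
  moreover have "mtopology closure_of S \<subseteq> \<Union> (range (\<lambda>x. mball x (R x)))"
    using R by (meson UN_I UNIV_I centre_in_mball_iff subsetI)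
  ultimately have "\<exists>\<F>. finite \<F> \<and> \<F> \<subseteq> range (\<lambda>x. mball x (R x)) \<and> mtopology closure_of S \<subseteq> \<Union>\<F>"
    by (rule compactinD)
  then obtain \<F> where "finite \<F>" "\<F> \<subseteq> range (\<lambda>x. mball x (R x))"
     "mtopology closure_of S \<subseteq> \<Union>\<F>" by (elim exE conjE)
  then obtain I where I: "finite I" "\<F> = (\<lambda>x. mball x (R x)) ` I"
    by (meson finite_subset_image)
  have "S \<subseteq> mtopology closure_of S" by (simp add: closure_of_subset)
  then have "S \<subseteq> (\<Union>p\<in>I. mball p (R p))"
    using \<open>mtopology closure_of S \<subseteq> \<Union>\<F>\<close> I(2) by auto
  then show thesis using R by (intro that[OF I(1)]) auto
qed

text \<open>The Hopf--Rinow argument: the radii of totally bounded balls form a set which is open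
  because balls are locally totally bounded and the space is complete, and closed because the space is a length space.\<close>

lemma mtotally_bounded_mball: "mtotally_bounded (mball x r)"
proof (rule ccontr)
  assume r: "\<not> mtotally_bounded (mball x r)"
  define T where "T = {r. mtotally_bounded (mball x r)}"
  have down: "s \<in> T" if "r' \<in> T" "s \<le> r'" for r' s
    using that mtotally_bounded_subset[of "mball x r'" "mball x s"] mball_subset_concentric[of s r' x]
    by (simp add: T_def)
  have "r \<notin> T" using r by (simp add: T_def)
  then have bdd: "bdd_above T" using down unfolding bdd_above_def by (meson linear)
  define s where "s = Sup T"
  have "\<exists>R>0. R \<in> T" using locally_doubling doubling_imp_mtotally_bounded unfolding T_def by blast
  then obtain R0 where R0: "R0 > 0" "R0 \<in> T" by blast
  then have s0: "s > 0" using cSup_upper[OF R0(2) bdd] by (simp add: s_def)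
  have ne: "T \<noteq> {}" using R0 by blast
  have below: "s' \<in> T" if "s' < s" for s'
  proof -
    have "s' < Sup T" using that by (simp add: s_def)
    then obtain r' where "r' \<in> T" "s' < r'" using ne by (rule less_cSupE)
    then show ?thesis using down by simp
  qed
  have tb: "mtotally_bounded (mball x s)"
  proof (rule mtotally_bounded_net)
    fix \<epsilon> :: real assume \<epsilon>: "\<epsilon> > 0"
    \<comment> \<open>A radius already known to be totally bounded, at most
      \<open>\<epsilon> / 4\<close> below \<open>s\<close>; the maximum with \<open>s / 2\<close>
      keeps it positive.\<close>
    define s' where "s' = max (s / 2) (s - \<epsilon> / 4)"
    have s': "0 < s'" "s' < s" "s - \<epsilon> / 4 \<le> s'" using s0 \<epsilon> by (auto simp: s'_def)
    have "mtotally_bounded (mball x s')" using below[OF s'(2)] by (simp add: T_def)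
    moreover have "\<epsilon> / 4 > 0" using \<epsilon> by simp
    ultimately obtain K where K: "finite K" "mball x s' \<subseteq> (\<Union>z\<in>K. mball z (\<epsilon> / 4))"
      unfolding mtotally_bounded_def by meson
    have "mball x s \<subseteq> (\<Union>z\<in>K. mcball z \<epsilon>)"
    proof
      fix y assume "y \<in> mball x s"
      then have xy: "d x y < s" by simp
      \<comment> \<open>The margin \<open>m\<close> puts \<open>z\<close> strictly inside the open
        ball of radius \<open>s'\<close>; the steps \<open>s' - m\<close> and
        \<open>\<epsilon> / 2\<close> still add up to at least
        \<open>s + \<epsilon> / 8\<close>.\<close>
      define m where "m = min (s' / 2) (\<epsilon> / 8)"
      have m: "0 < m" "m < s'" "m \<le> \<epsilon> / 8" using s'(1) \<epsilon> by (auto simp: m_def)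
      obtain z where z: "d x z \<le> s' - m" "d z y \<le> \<epsilon> / 2"
        using between[of "s' - m" "\<epsilon> / 2" x y] m s'(3) xy \<epsilon> by force
      then have "z \<in> mball x s'" using m by simp
      then obtain k where k: "k \<in> K" "d k z < \<epsilon> / 4" using K(2) by auto
      have "d k y \<le> \<epsilon>" using triangle[of k z y] z(2) k(2) \<epsilon> by simp
      then show "y \<in> (\<Union>z\<in>K. mcball z \<epsilon>)" using k(1) by auto
    qed
    then show "\<exists>K. finite K \<and> mball x s \<subseteq> (\<Union>x\<in>K. mcball x \<epsilon>)" using K(1) by blast
  qed
  then obtain I R where I: "finite I" "\<And>p. p \<in> I \<Longrightarrow> 0 < R p \<and> doubling (mball p (2 * R p))"
    "mball x s \<subseteq> (\<Union>p\<in>I. mball p (R p))"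
    using finite_doubling_cover by blast
  \<comment> \<open>Half of the common margin of the finitely many balls. Inserting \<open>s\<close>
    makes the set non-empty and keeps \<open>s - \<eta> / 2\<close> positive.\<close>
  define \<eta> where "\<eta> = Min (insert s (R ` I)) / 2"
  have \<eta>: "\<eta> > 0" "\<And>p. p \<in> I \<Longrightarrow> 2 * \<eta> \<le> R p" "2 * \<eta> \<le> s"
    using I(1,2) s0 by (auto simp: \<eta>_def)
  have "mball x (s + \<eta> / 2) \<subseteq> (\<Union>p\<in>I. mball p (2 * R p))"
  proof
    fix y assume "y \<in> mball x (s + \<eta> / 2)"
    then have "d x y < (s - \<eta> / 2) + \<eta>" by simp
    then obtain z where z: "d x z \<le> s - \<eta> / 2" "d z y \<le> \<eta>"
      using between[of "s - \<eta> / 2" \<eta> x y] \<eta> s0 by auto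
    then have "z \<in> mball x s" using \<eta>(1) by auto
    then obtain p where p: "p \<in> I" "d p z < R p" using I(3) by auto
    have "d p y < 2 * R p" using triangle[of p z y] p(2) z(2) \<eta>(1) \<eta>(2)[OF p(1)] by simp
    then show "y \<in> (\<Union>p\<in>I. mball p (2 * R p))" using p(1) by auto
  qed
  moreover have "mtotally_bounded (\<Union>p\<in>I. mball p (2 * R p))"
    using I(1,2) by (intro mtotally_bounded_Union) (auto intro: doubling_imp_mtotally_bounded)
  ultimately have "s + \<eta> / 2 \<in> T" unfolding T_def by (metis mtotally_bounded_subset mem_Collect_eq)
  then have "s + \<eta> / 2 \<le> s" unfolding s_def using bdd by (rule cSup_upper)
  then show False using \<eta>(1) by simp
qed

lemma mbounded_imp_mtotally_bounded:
  assumes "mbounded A"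
  shows "mtotally_bounded A"
proof -
  obtain x r where "A \<subseteq> mcball x r" using assms unfolding mbounded_def by blast
  moreover have "mcball x r \<subseteq> mball x (r + 1)" by auto
  ultimately show ?thesis by (meson mtotally_bounded_mball mtotally_bounded_subset order_trans)
qed

text \<open>Doubling with \<open>k = 8\<close> at scale \<open>r / 4\<close>, since
  \<open>8 * (r / 4) = 2 * r\<close>. The bound on \<open>r\<close> is half the least radius in a
  finite cover of \<open>A\<close> (capped at 1), so that \<open>mcball x (2 * r)\<close> stays
  inside one doubling ball; the largest of the finitely many constants serves as
  \<open>N\<close>.\<close>

lemma uniform_cover:
  assumes "mtotally_bounded A"
  obtains R N where "R > 0"
    "\<And>x r. x \<in> A \<Longrightarrow> 0 < r \<Longrightarrow> r < R \<Longrightarrow>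
       \<exists>P. finite P \<and> card P \<le> N \<and> mcball x (2 * r) \<subseteq> (\<Union>p\<in>P. mcball p (r / 4))"
proof -
  obtain I R where I: "finite I" "\<And>p. p \<in> I \<Longrightarrow> 0 < R p \<and> doubling (mball p (2 * R p))"
    "A \<subseteq> (\<Union>p\<in>I. mball p (R p))"
    using finite_doubling_cover[OF assms] by blast
  have "\<forall>p\<in>I. \<exists>N. \<forall>x\<in>mball p (2 * R p). \<forall>r>0. \<exists>P. finite P \<and> card P \<le> N \<and>
     mball p (2 * R p) \<inter> mcball x (8 * r) \<subseteq> (\<Union>p\<in>P. mcball p r)"
    using I(2) unfolding doubling_def by (meson zero_less_numeral)
  then obtain N where N: "\<And>p x r. p \<in> I \<Longrightarrow> x\<in>mball p (2 * R p) \<Longrightarrow> r > 0 \<Longrightarrow> \<exists>P. finite P \<and> card P \<le> N p \<and>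
     mball p (2 * R p) \<inter> mcball x (8 * r) \<subseteq> (\<Union>p\<in>P. mcball p r)" by metis
  define R' where "R' = Min (insert 1 (R ` I)) / 2"
  have R': "R' > 0" "\<And>p. p \<in> I \<Longrightarrow> 2 * R' \<le> R p"
    using I(1,2) by (auto simp: R'_def)
  show thesis
  proof (rule that[OF R'(1)])
    fix x r assume x: "x \<in> A" and r: "0 < r" "r < R'"
    obtain p where p: "p \<in> I" "d p x < R p" using I(3) x by auto
    have "mcball x (2 * r) \<subseteq> mball p (2 * R p)"
    proof
      fix y assume "y \<in> mcball x (2 * r)"
      then show "y \<in> mball p (2 * R p)"
        using triangle[of p x y] p(2) R'(2)[OF p(1)] r by simp
    qed
    moreover have "x \<in> mball p (2 * R p)" using p I(2)[OF p(1)] by simp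
    then obtain P where P: "finite P" "card P \<le> N p"
      "mball p (2 * R p) \<inter> mcball x (8 * (r / 4)) \<subseteq> (\<Union>p\<in>P. mcball p (r / 4))"
      using N[OF p(1), of x "r / 4"] r by auto
    moreover have "card P \<le> Max (N ` I)" using P(2) p(1) I(1)
      by (meson Max_ge finite_imageI imageI le_trans)
    ultimately show "\<exists>P. finite P \<and> card P \<le> Max (N ` I) \<and> mcball x (2 * r) \<subseteq> (\<Union>p\<in>P. mcball p (r / 4))"
      by (intro exI[of _ P]) (auto simp: Int_absorb1)
  qed
qed

text \<open>The number of classes is fixed before \<open>F\<close>, so it depends only on
  \<open>A\<close> and \<open>K\<close>. All of \<open>F\<close> is distributed among the classes,
  hence whatever \<open>F\<close> covers stays covered.\<close>

lemma bounded_overlap_imp_disjoint_families: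
  assumes A: "mbounded A"
  shows "\<exists>m::nat. \<forall>F. fst ` F \<subseteq> A \<longrightarrow> (\<forall>(x, r)\<in>F. 0 < r) \<longrightarrow>
      (\<forall>y. finite {(x, r)\<in>F. y \<in> mcball x r} \<and> card {(x, r)\<in>F. y \<in> mcball x r} \<le> K) \<longrightarrow>
      (\<exists>G :: nat \<Rightarrow> ('a \<times> real) set. (\<Union>i\<in>{1..m}. G i) = F \<and>
        (\<forall>i. pairwise (\<lambda>(x, r) (y, s). disjnt (mcball x r) (mcball y s)) (G i)))"
proof -
  have tb: "mtotally_bounded A" using A by (rule mbounded_imp_mtotally_bounded)
  obtain R N where R: "R > 0" and N: "\<And>x r. x \<in> A \<Longrightarrow> 0 < r \<Longrightarrow> r < R \<Longrightarrow>
       \<exists>P. finite P \<and> card P \<le> N \<and> mcball x (2 * r) \<subseteq> (\<Union>p\<in>P. mcball p (r / 4))"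
    using uniform_cover[OF tb] by blast
  have net: "\<exists>P. finite P \<and> A \<subseteq> (\<Union>p\<in>P. mball p \<epsilon>)" if "\<epsilon> > 0" for \<epsilon>
    using tb that unfolding mtotally_bounded_def by blast
  obtain P0 where P0: "finite P0" "A \<subseteq> (\<Union>p\<in>P0. mball p R)"
    using net[OF R] by blast
  \<comment> \<open>Every neighbour of at least equal radius contains one of at most
    \<open>max N (card P0)\<close> net points, and each of these lies in at most \<open>K\<close>
    balls.\<close>
  define D where "D = max N (card P0) * K"
  show ?thesis
  proof (intro exI[of _ "Suc D"] allI impI)
    fix F :: "('a \<times> real) set"
    assume FA: "fst ` F \<subseteq> A" and "\<forall>(x, r)\<in>F. 0 < r"
      and K: "\<forall>y. finite {(x, r)\<in>F. y \<in> mcball x r} \<and> card {(x, r)\<in>F. y \<in> mcball x r} \<le> K"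
    then have pos: "0 < r" if "(x, r) \<in> F" for x r using that by auto
    define H where "H y = {(x, r)\<in>F. y \<in> mcball x r}" for y
    have H: "finite (H y)" "card (H y) \<le> K" for y using K by (simp_all add: H_def)
    have hit: "finite Q \<and> card Q \<le> card P * K" if "finite P" "Q \<subseteq> (\<Union>p\<in>P. H p)" for P Q
    proof
      have fin: "finite (\<Union>p\<in>P. H p)" using that H by blast
      show "finite Q" using fin that(2) by (rule rev_finite_subset)
      have "card Q \<le> card (\<Union>p\<in>P. H p)" using fin that(2) by (rule card_mono)
      also have "\<dots> \<le> (\<Sum>p\<in>P. card (H p))" using that(1) by (rule card_UN_le)
      also have "\<dots> \<le> card P * K" using sum_bounded_above[of P "\<lambda>p. card (H p)" K] H(2) by simp
      finally show "card Q \<le> card P * K" .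
    qed
    \<comment> \<open>The centre of such a ball lies within \<open>\<epsilon>\<close> of some net
      point, so the ball itself contains that net point.\<close>
    have large: "{w\<in>F. \<epsilon> \<le> snd w} \<subseteq> (\<Union>p\<in>P. H p)" if P: "A \<subseteq> (\<Union>p\<in>P. mball p \<epsilon>)" for P \<epsilon>
    proof
      fix w assume w: "w \<in> {w\<in>F. \<epsilon> \<le> snd w}"
      then have "fst w \<in> A" using FA by (auto simp: image_subset_iff)
      then obtain p where p: "p \<in> P" "d p (fst w) < \<epsilon>" using P by auto
      then have "w \<in> H p"
        using w commute[of p "fst w"] by (simp add: H_def split_beta)
      then show "w \<in> (\<Union>p\<in>P. H p)" using p(1) by (rule UN_I[rotated])
    qed
    define E where "E = (\<lambda>v w. \<not> disjnt (mcball (fst v) (snd v)) (mcball (fst w) (snd w)))"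
    have "\<exists>col::'a \<times> real \<Rightarrow> nat. (\<forall>v\<in>F. col v \<le> D) \<and>
      (\<forall>u\<in>F. \<forall>v\<in>F. u \<noteq> v \<longrightarrow> E u v \<longrightarrow> col u \<noteq> col v)"
    proof (rule bounded_degree_colouring[of F snd])
      fix v assume "v \<in> F"
      then have "snd v > 0" using pos[of "fst v" "snd v"] by simp
      then obtain P where P: "finite P" "A \<subseteq> (\<Union>p\<in>P. mball p (snd v))" using net by meson
      show "finite {w\<in>F. snd v \<le> snd w}" using hit[OF P(1) large[OF P(2)]] by (rule conjunct1)
    next
      fix v assume v: "v \<in> F"
      obtain x r where vr: "v = (x, r)" by force
      have r: "r > 0" and x: "x \<in> A" using v pos FA by (auto simp: vr image_subset_iff)
      define Q where "Q = {w\<in>F. snd v \<le> snd w \<and> E w v}"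
      show "card {w\<in>F. snd v \<le> snd w \<and> E w v} \<le> D"
      proof (cases "r < R")
        case True
        then obtain P where P: "finite P" "card P \<le> N" "mcball x (2 * r) \<subseteq> (\<Union>p\<in>P. mcball p (r / 4))"
          using N[OF x r] by blast
        have "Q \<subseteq> (\<Union>p\<in>P. H p)"
        proof
          fix w assume "w \<in> Q"
          then obtain y s where w: "w = (y, s)" "(y, s) \<in> F" "r \<le> s" "E (y, s) (x, r)"
            by (cases w) (auto simp: Q_def vr)
          then obtain u where u: "d y u \<le> s" "d x u \<le> r" by (auto simp: E_def disjnt_def)
          \<comment> \<open>The budget: the sum exceeds \<open>s\<close> by \<open>r / 4\<close>,
            which gives strictness; \<open>z\<close> lies \<open>r / 2\<close> deep in
            \<open>B(y, s)\<close>, more than the net width \<open>r / 4\<close>; and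
            \<open>r + 3 * r / 4\<close> is below \<open>2 * r\<close>. The first summand is
            positive because \<open>r \<le> s\<close>.\<close>
          have "d y u < (s - r / 2) + 3 * r / 4" using u r by simp
          then obtain z where z: "d y z \<le> s - r / 2" "d z u \<le> 3 * r / 4"
            using between[of "s - r / 2" "3 * r / 4" y u] w(3) r by auto
          have "z \<in> mcball x (2 * r)" using triangle[of x u z] u z(2) commute[of z u] r by simp
          then obtain p where p: "p \<in> P" "d p z \<le> r / 4" using P(3) by auto
          have "d y p \<le> s" using triangle[of y z p] z(1) p(2) commute[of p z] r by simp
          then show "w \<in> (\<Union>p\<in>P. H p)" using p(1) w by (auto simp: H_def)
        qed
        from conjunct2[OF hit[OF P(1) this]] have "card Q \<le> card P * K" .
        also have "\<dots> \<le> D" using P(2) unfolding D_def by (intro mult_right_mono) auto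
        finally show ?thesis by (simp add: Q_def)
      next
        case False
        have "Q \<subseteq> {w\<in>F. R \<le> snd w}" using False by (auto simp: Q_def vr)
        also have "\<dots> \<subseteq> (\<Union>p\<in>P0. H p)" by (rule large[OF P0(2)])
        finally have "Q \<subseteq> (\<Union>p\<in>P0. H p)" .
        from conjunct2[OF hit[OF P0(1) this]] have "card Q \<le> card P0 * K" .
        also have "\<dots> \<le> D" unfolding D_def by (intro mult_right_mono) auto
        finally show ?thesis by (simp add: Q_def)
      qed
    next
      show "E v u" if "E u v" for u v using that unfolding E_def using disjnt_sym by blast
    qed
    then obtain col :: "'a \<times> real \<Rightarrow> nat" where col: "\<forall>v\<in>F. col v \<le> D"
      "\<forall>u\<in>F. \<forall>v\<in>F. u \<noteq> v \<longrightarrow> E u v \<longrightarrow> col u \<noteq> col v" by (elim exE conjE)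
    \<comment> \<open>Colours run from 0 to \<open>D\<close>, classes from 1 to
      \<open>D + 1\<close>.\<close>
    define G where "G i = {v\<in>F. Suc (col v) = i}" for i
    have "(\<Union>i\<in>{1..Suc D}. G i) = F" using col(1) by (auto simp: G_def Suc_le_eq less_Suc_eq_le)
    moreover have "\<forall>i. pairwise (\<lambda>(x, r) (y, s). disjnt (mcball x r) (mcball y s)) (G i)"
    proof (intro allI pairwiseI)
      fix i v w assume "v \<in> G i" "w \<in> G i" "v \<noteq> w"
      then have "v \<in> F" "w \<in> F" "col v = col w" by (auto simp: G_def)
      then have "\<not> E v w" using col(2) \<open>v \<noteq> w\<close> by metis
      then show "(\<lambda>(x, r) (y, s). disjnt (mcball x r) (mcball y s)) v w"
        by (simp add: E_def split_beta)
    qed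
    ultimately show "\<exists>G :: nat \<Rightarrow> ('a \<times> real) set. (\<Union>i\<in>{1..Suc D}. G i) = F \<and>
        (\<forall>i. pairwise (\<lambda>(x, r) (y, s). disjnt (mcball x r) (mcball y s)) (G i))" by blast
  qed
qed

end

section \<open>The metric tensor and the speed of curves\<close>

context riemannian_manifold
begin

section \<open>Quadratic form estimates for the metric tensor\<close>

lemma metric_zero: "c \<in> atlas \<Longrightarrow> q \<in> chart_ran c \<Longrightarrow> g c q 0 0 = 0"
  using metric_bilinear bilinear_lzero by blast

lemma metric_nonneg: "c \<in> atlas \<Longrightarrow> q \<in> chart_ran c \<Longrightarrow> 0 \<le> g c q v v"
  by (cases "v = 0") (auto simp: metric_zero less_imp_le metric_pos)

lemma metric_scaleR:
  assumes "c \<in> atlas" "q \<in> chart_ran c"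
  shows "g c q (k *\<^sub>R v) (k *\<^sub>R v) = k\<^sup>2 * g c q v v"
  using bilinear_lmul[OF metric_bilinear[OF assms]] bilinear_rmul[OF metric_bilinear[OF assms]]
  by (simp add: power2_eq_square)

lemma continuous_on_metric_point: "c \<in> atlas \<Longrightarrow> continuous_on (chart_ran c) (\<lambda>q. g c q v w)"
  using metric_smooth[of c v w] Ck_on.simps(1)[of "chart_ran c"] unfolding smooth_on_def by blast

lemma metric_expand:
  assumes "c \<in> atlas" "q \<in> chart_ran c"
  shows "g c q v v = (\<Sum>i\<in>Basis. \<Sum>j\<in>Basis. (v \<bullet> i) * ((v \<bullet> j) * g c q i j))"
proof -
  have bl: "bilinear (g c q)" by (rule metric_bilinear[OF assms])
  have "g c q v v = g c q (\<Sum>i\<in>Basis. (v \<bullet> i) *\<^sub>R i) (\<Sum>i\<in>Basis. (v \<bullet> i) *\<^sub>R i)"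
    by (simp add: euclidean_representation)
  also have "\<dots> = (\<Sum>(i, j)\<in>Basis \<times> Basis. g c q ((v \<bullet> i) *\<^sub>R i) ((v \<bullet> j) *\<^sub>R j))"
    by (rule bilinear_sum[OF bl])
  also have "\<dots> = (\<Sum>i\<in>Basis. \<Sum>j\<in>Basis. g c q ((v \<bullet> i) *\<^sub>R i) ((v \<bullet> j) *\<^sub>R j))"
    by (simp add: sum.cartesian_product)
  finally show ?thesis
    by (simp add: bilinear_lmul[OF bl] bilinear_rmul[OF bl] mult.left_commute)
qed

text \<open>Smoothness of the metric is given for fixed vectors only. Joint continuity in point and
  vector follows from the expansion in the basis, where finitely many such coefficients
  occur.\<close>

lemma continuous_on_metric:
  fixes p :: "'z::topological_space \<Rightarrow> 'e" and u :: "'z \<Rightarrow> 'e"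
  assumes c: "c \<in> atlas" and p: "continuous_on S p" "p ` S \<subseteq> chart_ran c"
    and u: "continuous_on S u"
  shows "continuous_on S (\<lambda>t. g c (p t) (u t) (u t))"
proof -
  have "continuous_on S (\<lambda>t. g c (p t) i j)" for i j
    using continuous_on_compose2[OF continuous_on_metric_point[OF c] p(1) p(2)] .
  then have "continuous_on S (\<lambda>t. \<Sum>i\<in>Basis. \<Sum>j\<in>Basis. (u t \<bullet> i) * ((u t \<bullet> j) * g c (p t) i j))"
    by (intro continuous_intros u)
  then show ?thesis
    by (rule continuous_on_eq) (use metric_expand[OF c] p(2) in \<open>auto simp: image_subset_iff\<close>)
qed

text \<open>The quadratic form attains positive extrema on the compact set
  \<open>K \<times> sphere 0 1\<close>, and homogeneity extends the bounds to all vectors. These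
  constants make Riemannian and coordinate distance comparable.\<close>

lemma metric_bounds:
  assumes c: "c \<in> atlas" and K: "compact K" "K \<subseteq> chart_ran c"
  obtains l u where "0 < l" "0 < u"
    "\<And>q v. q \<in> K \<Longrightarrow> l * norm v \<le> sqrt (g c q v v) \<and> sqrt (g c q v v) \<le> u * norm v"
proof (cases "K = {}")
  case True
  then show thesis using that[of 1 1] by simp
next
  case False
  let ?S = "K \<times> sphere (0::'e) 1"
  let ?f = "\<lambda>z. g c (fst z) (snd z) (snd z)"
  have S: "compact ?S" "?S \<noteq> {}" using K(1) False by (auto intro: compact_Times)
  have cont: "continuous_on ?S ?f"
    using K(2) by (intro continuous_on_metric[OF c] continuous_intros) auto
  have pos: "0 < ?f z" if "z \<in> ?S" for z
    using that K(2) by (intro metric_pos[OF c]) auto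
  obtain z1 where z1: "z1 \<in> ?S" "\<And>z. z \<in> ?S \<Longrightarrow> ?f z1 \<le> ?f z"
    using continuous_attains_inf[OF S cont] by blast
  obtain z2 where z2: "z2 \<in> ?S" "\<And>z. z \<in> ?S \<Longrightarrow> ?f z \<le> ?f z2"
    using continuous_attains_sup[OF S cont] by blast
  show thesis
  proof (rule that[of "sqrt (?f z1)" "sqrt (?f z2)"])
    show "0 < sqrt (?f z1)" "0 < sqrt (?f z2)" using pos z1(1) z2(1) by (simp_all only: real_sqrt_gt_0_iff)
    fix q v assume q: "q \<in> K"
    show "sqrt (?f z1) * norm v \<le> sqrt (g c q v v) \<and> sqrt (g c q v v) \<le> sqrt (?f z2) * norm v"
    proof (cases "v = 0")
      case True
      then show ?thesis using metric_zero[OF c, of q] q K(2) by auto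
    next
      case False
      define w where "w = (1 / norm v) *\<^sub>R v"
      have w: "(q, w) \<in> ?S" using q False by (simp add: w_def)
      have v: "v = norm v *\<^sub>R w" using False by (simp add: w_def)
      have "g c q v v = (norm v)\<^sup>2 * ?f (q, w)"
        using metric_scaleR[OF c, of q "norm v" w] q K(2) v by auto
      then have "sqrt (g c q v v) = sqrt (?f (q, w)) * norm v"
        by (simp add: real_sqrt_mult)
      then show ?thesis
        using z1(2)[OF w] z2(2)[OF w] by (simp add: mult_right_mono)
    qed
  qed
qed

section \<open>Charts and the transformation of velocity vectors\<close>

lemma chart_open_dom: "c \<in> atlas \<Longrightarrow> open (chart_dom c)"
  and chart_open_ran: "c \<in> atlas \<Longrightarrow> open (chart_ran c)"
  using chart_open by auto

lemma continuous_on_chart_map: "c \<in> atlas \<Longrightarrow> continuous_on (chart_dom c) (chart_map c)"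
  and continuous_on_chart_inv: "c \<in> atlas \<Longrightarrow> continuous_on (chart_ran c) (chart_inv c)"
  and chart_inv_chart_map: "c \<in> atlas \<Longrightarrow> x \<in> chart_dom c \<Longrightarrow> chart_inv c (chart_map c x) = x"
  and chart_map_chart_inv: "q \<in> chart_ran c \<Longrightarrow> chart_map c (chart_inv c q) = q"
  and chart_inv_dom: "q \<in> chart_ran c \<Longrightarrow> chart_inv c q \<in> chart_dom c"
  using chart_homeomorphism[of c] by (auto simp: homeomorphism_def f_inv_into_f inv_into_into)

lemma ex_chart: obtains c where "c \<in> atlas" "x \<in> chart_dom c"
  using charts_cover by blast

lemma transition_derivative:
  assumes "c \<in> atlas" "d \<in> atlas" "q \<in> chart_map c ` (chart_dom c \<inter> chart_dom d)"
  shows "(transition c d has_derivative frechet_derivative (transition c d) (at q)) (at q)"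
proof -
  have "Ck_on (Suc 0) (chart_map c ` (chart_dom c \<inter> chart_dom d)) (transition c d)"
    using transition_smooth[OF assms(1,2)] unfolding smooth_on_def by blast
  then have "transition c d differentiable (at q)" using assms(3) by (auto simp del: comp_apply)
  then show ?thesis by (simp add: frechet_derivative_works del: comp_apply)
qed

lemma continuous_on_transition_derivative:
  assumes "c \<in> atlas" "d \<in> atlas"
  shows "continuous_on (chart_map c ` (chart_dom c \<inter> chart_dom d))
    (\<lambda>q. frechet_derivative (transition c d) (at q) v)"
proof -
  have "Ck_on (Suc 0) (chart_map c ` (chart_dom c \<inter> chart_dom d)) (transition c d)"
    using transition_smooth[OF assms] unfolding smooth_on_def by blast
  then show ?thesis by (simp del: comp_apply)
qed

text \<open>The chain rule for the transition map. The factorization of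
  \<open>chart_map d \<circ> \<gamma>\<close> through \<open>c\<close> is valid only while
  \<open>\<gamma>\<close> stays in the domain of \<open>c\<close>, that is, near \<open>t\<close>;
  hence the detour through an eventual equality.\<close>

lemma curve_derivative_transition:
  assumes c: "c \<in> atlas" and d: "d \<in> atlas" and t: "\<gamma> t \<in> chart_dom c" "\<gamma> t \<in> chart_dom d" "t \<in> T"
    and cont: "continuous_on T \<gamma>"
    and v: "((chart_map c \<circ> \<gamma>) has_vector_derivative v) (at t within T)"
  shows "((chart_map d \<circ> \<gamma>) has_vector_derivative
    frechet_derivative (transition c d) (at (chart_map c (\<gamma> t))) v) (at t within T)"
proof -
  let ?q = "chart_map c (\<gamma> t)" and ?D = "frechet_derivative (transition c d) (at (chart_map c (\<gamma> t)))"
  have D: "(transition c d has_derivative ?D) (at ?q)"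
    using t by (intro transition_derivative[OF c d]) auto
  have lin: "linear ?D" using D by (rule has_derivative_linear)
  have "((transition c d \<circ> (chart_map c \<circ> \<gamma>)) has_derivative ?D \<circ> (\<lambda>h. h *\<^sub>R v)) (at t within T)"
    using v has_derivative_at_withinI[OF D] unfolding has_vector_derivative_def
    by (intro diff_chain_within) simp_all
  moreover have "?D \<circ> (\<lambda>h. h *\<^sub>R v) = (\<lambda>h. h *\<^sub>R ?D v)"
    using linear_scale[OF lin] by (auto simp: fun_eq_iff)
  ultimately have *: "((transition c d \<circ> (chart_map c \<circ> \<gamma>)) has_vector_derivative ?D v) (at t within T)"
    by (simp only: has_vector_derivative_def)
  have "(\<gamma> \<longlongrightarrow> \<gamma> t) (at t within T)" using cont t(3) by (simp add: continuous_on_def)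
  then have ev: "\<forall>\<^sub>F s in at t within T. \<gamma> s \<in> chart_dom c"
    using chart_open_dom[OF c] t(1) by (rule topological_tendstoD)
  have "((chart_map d \<circ> \<gamma>) has_derivative (\<lambda>h. h *\<^sub>R ?D v)) (at t within T)"
  proof (rule has_derivative_transform_eventually[OF *[unfolded has_vector_derivative_def]])
    show "\<forall>\<^sub>F s in at t within T. (transition c d \<circ> (chart_map c \<circ> \<gamma>)) s = (chart_map d \<circ> \<gamma>) s"
      using ev by eventually_elim (simp add: chart_inv_chart_map[OF c])
  qed (use t chart_inv_chart_map[OF c] in auto)
  then show ?thesis by (simp add: has_vector_derivative_def)
qed

text \<open>Derivatives within \<open>T\<close> include the one-sided ones at the end points of a
  curve. Uniqueness of the derivative, which needs a nontrivial filter, identifies \<open>w\<close>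
  with the image of \<open>v\<close> under the transition map.\<close>

lemma speed_chart_independent:
  assumes c: "c \<in> atlas" and d: "d \<in> atlas" and t: "\<gamma> t \<in> chart_dom c" "\<gamma> t \<in> chart_dom d" "t \<in> T"
    and cont: "continuous_on T \<gamma>" and T: "at t within T \<noteq> bot"
    and v: "((chart_map c \<circ> \<gamma>) has_vector_derivative v) (at t within T)"
    and w: "((chart_map d \<circ> \<gamma>) has_vector_derivative w) (at t within T)"
  shows "g c (chart_map c (\<gamma> t)) v v = g d (chart_map d (\<gamma> t)) w w"
proof -
  have "w = frechet_derivative (transition c d) (at (chart_map c (\<gamma> t))) v"
    by (rule vector_derivative_unique_within[OF T w curve_derivative_transition[OF c d t cont v]])
  then show ?thesis
    using metric_transform[OF c d, of "chart_map c (\<gamma> t)" v v] t chart_inv_chart_map[OF c t(1)]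
    by auto
qed

text \<open>Along a \<open>C\<^sup>1\<close> curve, the speed extends continuously to the end points, where the two-sided
  derivative in \<open>speed\<close> need not exist.\<close>

lemma C1_curve_speed:
  assumes "C1_curve atlas \<gamma> a b"
  obtains \<sigma> where "continuous_on {a..b} \<sigma>" "\<And>t. t \<in> {a..b} \<Longrightarrow> 0 \<le> \<sigma> t"
    "\<And>c t v. c \<in> atlas \<Longrightarrow> t \<in> {a..b} \<Longrightarrow> \<gamma> t \<in> chart_dom c \<Longrightarrow>
      ((chart_map c \<circ> \<gamma>) has_vector_derivative v) (at t within {a..b}) \<Longrightarrow>
      \<sigma> t = sqrt (g c (chart_map c (\<gamma> t)) v v)"
    "\<And>t. t \<in> {a<..<b} \<Longrightarrow> speed atlas g \<gamma> t = \<sigma> t"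
proof -
  have ab: "a < b" and cont: "continuous_on {a..b} \<gamma>"
    using assms by (auto simp: C1_curve_def)
  have "\<forall>c\<in>atlas. \<exists>D. continuous_on {t\<in>{a..b}. \<gamma> t \<in> chart_dom c} D \<and>
      (\<forall>t\<in>{a..b}. \<gamma> t \<in> chart_dom c \<longrightarrow>
        ((chart_map c \<circ> \<gamma>) has_vector_derivative D t) (at t within {a..b}))"
    using assms by (auto simp: C1_curve_def)
  from bchoice[OF this] obtain D where "\<forall>c\<in>atlas. continuous_on {t\<in>{a..b}. \<gamma> t \<in> chart_dom c} (D c) \<and>
      (\<forall>t\<in>{a..b}. \<gamma> t \<in> chart_dom c \<longrightarrow>
        ((chart_map c \<circ> \<gamma>) has_vector_derivative D c t) (at t within {a..b}))" ..
  then have D: "\<And>c. c \<in> atlas \<Longrightarrow> continuous_on {t\<in>{a..b}. \<gamma> t \<in> chart_dom c} (D c)"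
    "\<And>c t. c \<in> atlas \<Longrightarrow> t \<in> {a..b} \<Longrightarrow> \<gamma> t \<in> chart_dom c \<Longrightarrow>
        ((chart_map c \<circ> \<gamma>) has_vector_derivative D c t) (at t within {a..b})" by simp_all
  have T: "at t within {a..b} \<noteq> bot" if "t \<in> {a..b}" for t
    using that ab by (simp add: trivial_limit_within islimpt_Icc)
  \<comment> \<open>The same choice as in the definition of \<open>speed\<close>, so that interior
    values agree by unfolding.\<close>
  define ch where "ch t = (SOME c. c \<in> atlas \<and> \<gamma> t \<in> chart_dom c)" for t
  have ch: "ch t \<in> atlas" "\<gamma> t \<in> chart_dom (ch t)" for t
  proof -
    have "\<exists>c. c \<in> atlas \<and> \<gamma> t \<in> chart_dom c" using charts_cover by blast
    from someI_ex[OF this] show "ch t \<in> atlas" "\<gamma> t \<in> chart_dom (ch t)"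
      unfolding ch_def by simp_all
  qed
  define \<sigma> where "\<sigma> t = sqrt (g (ch t) (chart_map (ch t) (\<gamma> t)) (D (ch t) t) (D (ch t) t))" for t
  have \<sigma>: "\<sigma> t = sqrt (g c (chart_map c (\<gamma> t)) v v)"
    if "c \<in> atlas" "t \<in> {a..b}" "\<gamma> t \<in> chart_dom c"
      "((chart_map c \<circ> \<gamma>) has_vector_derivative v) (at t within {a..b})" for c t v
    unfolding \<sigma>_def
    using speed_chart_independent[OF ch(1) that(1) ch(2) that(3,2) cont T[OF that(2)] D(2)[OF ch(1) that(2) ch(2)] that(4)]
    by simp
  show thesis
  proof (rule that[of \<sigma>])
    show "continuous_on {a..b} \<sigma>"
      unfolding continuous_on_eq_continuous_within
    proof
      fix t assume t: "t \<in> {a..b}"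
      \<comment> \<open>The chart \<open>ch s\<close> may change erratically with \<open>s\<close>.
        Near \<open>t\<close> it is exchanged for one fixed chart \<open>c\<close>, in which every
        ingredient of the speed is continuous.\<close>
      obtain c where c: "c \<in> atlas" "\<gamma> t \<in> chart_dom c" by (rule ex_chart)
      let ?S = "{t\<in>{a..b}. \<gamma> t \<in> chart_dom c}"
      have "openin (top_of_set {a..b}) ({a..b} \<inter> \<gamma> -` chart_dom c)"
        using cont chart_open_dom[OF c(1)] by (rule continuous_openin_preimage_gen)
      moreover have "?S = {a..b} \<inter> \<gamma> -` chart_dom c" by auto
      ultimately obtain U where U: "open U" "?S = {a..b} \<inter> U"
        unfolding openin_open by metis
      have "continuous_on ?S (\<lambda>s. sqrt (g c (chart_map c (\<gamma> s)) (D c s) (D c s)))"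
      proof (intro continuous_intros continuous_on_metric[OF c(1)] D(1)[OF c(1)])
        show "continuous_on ?S (\<lambda>s. chart_map c (\<gamma> s))"
          by (rule continuous_on_compose2[OF continuous_on_chart_map[OF c(1)]])
            (auto intro: continuous_on_subset[OF cont])
      qed auto
      then have "continuous_on ?S \<sigma>"
        by (rule continuous_on_eq) (use \<sigma>[OF c(1) _ _ D(2)[OF c(1)]] in auto)
      then have "continuous (at t within ?S) \<sigma>"
        using t c(2) by (simp add: continuous_on_eq_continuous_within)
      moreover have "at t within ?S = at t within {a..b}"
        unfolding U(2) using U c(2) t by (intro at_within_nhd[of t U]) auto
      ultimately show "continuous (at t within {a..b}) \<sigma>" by simp
    qed
    show "0 \<le> \<sigma> t" for t
      unfolding \<sigma>_def using ch by (intro real_sqrt_ge_zero metric_nonneg) auto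
    show "speed atlas g \<gamma> t = \<sigma> t" if "t \<in> {a<..<b}" for t
    proof -
      have t: "t \<in> {a..b}" using that by auto
      have "at t within {a..b} = at t" using that by (simp add: at_within_Icc_at)
      then have "((chart_map (ch t) \<circ> \<gamma>) has_vector_derivative D (ch t) t) (at t)"
        using D(2)[OF ch(1) t ch(2)] by simp
      then have "vector_derivative (chart_map (ch t) \<circ> \<gamma>) (at t) = D (ch t) t"
        by (rule vector_derivative_at)
      then show ?thesis by (simp only: speed_def Let_def \<sigma>_def ch_def)
    qed
  qed (use \<sigma> in blast)
qed

lemma C1_curve_length:
  assumes "C1_curve atlas \<gamma> a b"
  shows "speed atlas g \<gamma> integrable_on {a..b}" and "0 \<le> curve_length atlas g \<gamma> a b"
proof -
  obtain \<sigma> where \<sigma>: "continuous_on {a..b} \<sigma>" "\<And>t. t \<in> {a..b} \<Longrightarrow> 0 \<le> \<sigma> t"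
    "\<And>t. t \<in> {a<..<b} \<Longrightarrow> speed atlas g \<gamma> t = \<sigma> t"
    using C1_curve_speed[OF assms] by metis
  have "(\<sigma> has_integral integral {a..b} \<sigma>) {a..b}"
    using integrable_continuous_real[OF \<sigma>(1)] by (rule integrable_integral)
  then have "(speed atlas g \<gamma> has_integral integral {a..b} \<sigma>) {a..b}"
    by (rule has_integral_spike_finite[of "{a, b}", rotated 2]) (use \<sigma>(3) in auto)
  moreover have "0 \<le> integral {a..b} \<sigma>"
    using integrable_continuous_real[OF \<sigma>(1)] \<sigma>(2) by (rule integral_nonneg)
  ultimately show "speed atlas g \<gamma> integrable_on {a..b}" "0 \<le> curve_length atlas g \<gamma> a b"
    by (auto simp: curve_length_def has_integral_integrable_integral)
qed

lemma C1_curve_derivative: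
  assumes "C1_curve atlas \<gamma> a b" "c \<in> atlas"
  obtains D where "continuous_on {t\<in>{a..b}. \<gamma> t \<in> chart_dom c} D"
    "\<forall>t\<in>{a..b}. \<gamma> t \<in> chart_dom c \<longrightarrow>
      ((chart_map c \<circ> \<gamma>) has_vector_derivative D t) (at t within {a..b})"
proof -
  have "\<exists>D. continuous_on {t\<in>{a..b}. \<gamma> t \<in> chart_dom c} D \<and>
      (\<forall>t\<in>{a..b}. \<gamma> t \<in> chart_dom c \<longrightarrow>
        ((chart_map c \<circ> \<gamma>) has_vector_derivative D t) (at t within {a..b}))"
    using assms by (simp add: C1_curve_def)
  then show thesis by (elim exE conjE) (rule that)
qed

lemma C1_curve_subinterval:
  assumes "C1_curve atlas \<gamma> a b" "a \<le> a'" "a' < b'" "b' \<le> b"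
  shows "C1_curve atlas \<gamma> a' b'"
  unfolding C1_curve_def
proof (intro conjI ballI)
  have sub: "{a'..b'} \<subseteq> {a..b}" using assms by auto
  show "a' < b'" "continuous_on {a'..b'} \<gamma>"
    using assms sub by (auto simp: C1_curve_def intro: continuous_on_subset)
  fix c assume "c \<in> atlas"
  from C1_curve_derivative[OF assms(1) this]
  obtain D where D: "continuous_on {t\<in>{a..b}. \<gamma> t \<in> chart_dom c} D"
    "\<forall>t\<in>{a..b}. \<gamma> t \<in> chart_dom c \<longrightarrow>
      ((chart_map c \<circ> \<gamma>) has_vector_derivative D t) (at t within {a..b})" .
  then show "\<exists>D. continuous_on {t\<in>{a'..b'}. \<gamma> t \<in> chart_dom c} D \<and>
      (\<forall>t\<in>{a'..b'}. \<gamma> t \<in> chart_dom c \<longrightarrow>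
        ((chart_map c \<circ> \<gamma>) has_vector_derivative D t) (at t within {a'..b'}))"
    using sub by (intro exI[of _ D] conjI ballI impI)
      (auto elim!: continuous_on_subset
        intro: has_vector_derivative_within_subset[where S = "{a..b}"])
qed

end

section \<open>Chains of curves\<close>

context riemannian_manifold
begin

section \<open>Reparametrization and gluing of curves\<close>

lemma curve_length_eq_integral:
  assumes "\<And>t. t \<in> {a<..<b} \<Longrightarrow> speed atlas g \<gamma> t = \<sigma> t"
  shows "curve_length atlas g \<gamma> a b = integral {a..b} \<sigma>"
  unfolding curve_length_def
  by (rule integral_spike[of "{a, b}"]) (use assms in auto)

text \<open>Translation (\<open>m = 1\<close>) serves concatenation, reversal
  (\<open>m = - 1\<close>) serves symmetry of the distance. Both leave the speed unchanged because
  \<open>m\<^sup>2 = 1\<close>.\<close>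

lemma C1_curve_affine:
  assumes \<gamma>: "C1_curve atlas \<gamma> a b" and ab: "a' < b'"
    and m: "m = 1 \<and> a = a' + k \<and> b = b' + k \<or> m = - 1 \<and> a = k - b' \<and> b = k - a'"
  defines "\<phi> \<equiv> \<lambda>t. m * t + k"
  shows "C1_curve atlas (\<gamma> \<circ> \<phi>) a' b'"
    and "curve_length atlas g (\<gamma> \<circ> \<phi>) a' b' = curve_length atlas g \<gamma> a b"
proof -
  have im: "\<phi> ` {a'..b'} = {a..b}" using m ab by (auto simp: \<phi>_def image_affinity_atLeastAtMost)
  have \<phi>: "\<phi> t \<in> {a..b}" if "t \<in> {a'..b'}" for t using that im by blast
  have cont_\<phi>: "continuous_on S \<phi>" for S unfolding \<phi>_def by (intro continuous_intros)
  have deriv_\<phi>: "(\<phi> has_vector_derivative m) (at t within S)" for t S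
    unfolding \<phi>_def by (auto intro!: derivative_eq_intros simp: has_vector_derivative_def)
  have deriv: "((chart_map c \<circ> (\<gamma> \<circ> \<phi>)) has_vector_derivative m *\<^sub>R v) (at t within {a'..b'})"
    if "((chart_map c \<circ> \<gamma>) has_vector_derivative v) (at (\<phi> t) within {a..b})" for c t v
  proof -
    have "((chart_map c \<circ> \<gamma> \<circ> \<phi>) has_vector_derivative m *\<^sub>R v) (at t within {a'..b'})"
      by (rule vector_diff_chain_within[OF deriv_\<phi>]) (use that im in simp)
    then show ?thesis by (simp add: comp_assoc)
  qed
  show C1: "C1_curve atlas (\<gamma> \<circ> \<phi>) a' b'"
    unfolding C1_curve_def
  proof (intro conjI ballI)
    show "continuous_on {a'..b'} (\<gamma> \<circ> \<phi>)"
      using \<gamma> by (intro continuous_on_compose cont_\<phi>) (simp add: im C1_curve_def)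
    fix c assume "c \<in> atlas"
    from C1_curve_derivative[OF \<gamma> this]
    obtain D where D: "continuous_on {t\<in>{a..b}. \<gamma> t \<in> chart_dom c} D"
      "\<forall>t\<in>{a..b}. \<gamma> t \<in> chart_dom c \<longrightarrow>
        ((chart_map c \<circ> \<gamma>) has_vector_derivative D t) (at t within {a..b})" .
    have "continuous_on {t\<in>{a'..b'}. (\<gamma> \<circ> \<phi>) t \<in> chart_dom c} (\<lambda>t. m *\<^sub>R D (\<phi> t))"
      by (intro continuous_intros continuous_on_compose2[OF D(1)] cont_\<phi>) (use \<phi> in auto)
    moreover have "\<forall>t\<in>{a'..b'}. (\<gamma> \<circ> \<phi>) t \<in> chart_dom c \<longrightarrow>
      ((chart_map c \<circ> (\<gamma> \<circ> \<phi>)) has_vector_derivative m *\<^sub>R D (\<phi> t)) (at t within {a'..b'})"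
      by (intro ballI impI deriv D(2)[rule_format] \<phi>) auto
    ultimately show "\<exists>D. continuous_on {t\<in>{a'..b'}. (\<gamma> \<circ> \<phi>) t \<in> chart_dom c} D \<and>
      (\<forall>t\<in>{a'..b'}. (\<gamma> \<circ> \<phi>) t \<in> chart_dom c \<longrightarrow>
        ((chart_map c \<circ> (\<gamma> \<circ> \<phi>)) has_vector_derivative D t) (at t within {a'..b'}))"
      by (intro exI conjI)
  qed (use ab in simp)
  obtain \<sigma> where \<sigma>: "\<And>c t v. c \<in> atlas \<Longrightarrow> t \<in> {a..b} \<Longrightarrow> \<gamma> t \<in> chart_dom c \<Longrightarrow>
      ((chart_map c \<circ> \<gamma>) has_vector_derivative v) (at t within {a..b}) \<Longrightarrow>
      \<sigma> t = sqrt (g c (chart_map c (\<gamma> t)) v v)"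
    "\<And>t. t \<in> {a<..<b} \<Longrightarrow> speed atlas g \<gamma> t = \<sigma> t"
    using C1_curve_speed[OF \<gamma>] by metis
  obtain \<sigma>' where \<sigma>': "\<And>c t v. c \<in> atlas \<Longrightarrow> t \<in> {a'..b'} \<Longrightarrow> (\<gamma> \<circ> \<phi>) t \<in> chart_dom c \<Longrightarrow>
      ((chart_map c \<circ> (\<gamma> \<circ> \<phi>)) has_vector_derivative v) (at t within {a'..b'}) \<Longrightarrow>
      \<sigma>' t = sqrt (g c (chart_map c ((\<gamma> \<circ> \<phi>) t)) v v)"
    "\<And>t. t \<in> {a'<..<b'} \<Longrightarrow> speed atlas g (\<gamma> \<circ> \<phi>) t = \<sigma>' t"
    using C1_curve_speed[OF C1] by metis
  have eq: "\<sigma>' t = \<sigma> (\<phi> t)" if t: "t \<in> {a'..b'}" for t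
  proof -
    obtain c where c: "c \<in> atlas" "\<gamma> (\<phi> t) \<in> chart_dom c" by (rule ex_chart)
    obtain v where v: "((chart_map c \<circ> \<gamma>) has_vector_derivative v) (at (\<phi> t) within {a..b})"
      using C1_curve_derivative[OF \<gamma> c(1)] \<phi>[OF t] c(2) by meson
    have "\<sigma>' t = sqrt (g c (chart_map c (\<gamma> (\<phi> t))) (m *\<^sub>R v) (m *\<^sub>R v))"
      using \<sigma>'(1)[OF c(1) t _ deriv[OF v]] c(2) by simp
    also have "\<dots> = sqrt (g c (chart_map c (\<gamma> (\<phi> t))) v v)"
      using metric_scaleR[OF c(1), of "chart_map c (\<gamma> (\<phi> t))" m v] c(2) m by auto
    also have "\<dots> = \<sigma> (\<phi> t)" using \<sigma>(1)[OF c(1) \<phi>[OF t] c(2) v] by simp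
    finally show ?thesis .
  qed
  have "curve_length atlas g (\<gamma> \<circ> \<phi>) a' b' = integral {a'..b'} (\<lambda>t. \<sigma> (\<phi> t))"
    by (rule curve_length_eq_integral) (use \<sigma>'(2) eq in auto)
  also have "\<dots> = integral {a..b} \<sigma>"
    using m
  proof (elim disjE conjE)
    assume "m = 1" "a = a' + k" "b = b' + k"
    then show ?thesis using integral_shift_real_ivl[of a k b \<sigma>] by (simp add: \<phi>_def)
  next
    assume "m = - 1" "a = k - b'" "b = k - a'"
    then show ?thesis
      using integral_shift_real_ivl[of "- b" "- k" "- a" "\<lambda>t. \<sigma> (- t)"] Henstock_Kurzweil_Integration.integral_reflect_real[of b a \<sigma>]
      by (simp add: \<phi>_def)
  qed
  also have "\<dots> = curve_length atlas g \<gamma> a b"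
    using curve_length_eq_integral[OF \<sigma>(2)] by simp
  finally show "curve_length atlas g (\<gamma> \<circ> \<phi>) a' b' = curve_length atlas g \<gamma> a b" .
qed

lemma C1_curve_cong:
  assumes "C1_curve atlas \<gamma> a b" "\<And>t. t \<in> {a..b} \<Longrightarrow> \<gamma>' t = \<gamma> t"
  shows "C1_curve atlas \<gamma>' a b"
proof -
  have "continuous_on {a..b} \<gamma>'"
    using assms continuous_on_cong[of "{a..b}" "{a..b}" \<gamma>' \<gamma>] by (simp add: C1_curve_def)
  moreover have "\<exists>D. continuous_on {t\<in>{a..b}. \<gamma>' t \<in> chart_dom c} D \<and>
      (\<forall>t\<in>{a..b}. \<gamma>' t \<in> chart_dom c \<longrightarrow>
        ((chart_map c \<circ> \<gamma>') has_vector_derivative D t) (at t within {a..b}))" if "c \<in> atlas" for c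
  proof -
    from C1_curve_derivative[OF assms(1) that]
    obtain D where D: "continuous_on {t\<in>{a..b}. \<gamma> t \<in> chart_dom c} D"
      "\<forall>t\<in>{a..b}. \<gamma> t \<in> chart_dom c \<longrightarrow>
        ((chart_map c \<circ> \<gamma>) has_vector_derivative D t) (at t within {a..b})" .
    have "{t\<in>{a..b}. \<gamma>' t \<in> chart_dom c} = {t\<in>{a..b}. \<gamma> t \<in> chart_dom c}"
      using assms(2) by auto
    moreover have "((chart_map c \<circ> \<gamma>') has_vector_derivative D t) (at t within {a..b})"
      if t: "t \<in> {a..b}" "\<gamma>' t \<in> chart_dom c" for t
    proof (rule has_vector_derivative_transform[OF t(1)])
      show "((chart_map c \<circ> \<gamma>) has_vector_derivative D t) (at t within {a..b})"
        using D(2) t assms(2) by simp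
    qed (simp add: assms(2))
    ultimately show ?thesis using D(1) by (intro exI[of _ D]) simp
  qed
  ultimately show ?thesis
    using assms(1) unfolding C1_curve_def by simp
qed

text \<open>Agreement on an open set is required since \<open>speed\<close> takes a two-sided
  derivative; lengths of glued curves are therefore compared off the joints.\<close>

lemma speed_cong:
  assumes U: "open U" "t \<in> U" and eq: "\<And>s. s \<in> U \<Longrightarrow> \<gamma>' s = \<gamma> s"
  shows "speed atlas g \<gamma>' t = speed atlas g \<gamma> t"
proof -
  have "vector_derivative (chart_map c \<circ> \<gamma>') (at t) = vector_derivative (chart_map c \<circ> \<gamma>) (at t)"
    for c :: "('a, 'e) chart"
    using U eq by (intro vector_derivative_cong_eq) (auto simp: eventually_nhds)
  then show ?thesis by (simp only: speed_def eq[OF U(2)] Let_def)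
qed

text \<open>The conclusion carries \<open>a < b\<close> for the sake of the induction: it places
  \<open>{b..c}\<close> inside \<open>{a..c}\<close>, where the curves agree.\<close>

lemma piecewise_C1_curve_cong:
  assumes "piecewise_C1_curve atlas \<gamma> a b" "\<And>t. t \<in> {a..b} \<Longrightarrow> \<gamma>' t = \<gamma> t"
  shows "a < b \<and> piecewise_C1_curve atlas \<gamma>' a b"
  using assms
proof induction
  case (C1 a b)
  then show ?case using C1_curve_cong[of \<gamma> a b \<gamma>'] by (auto simp: C1_curve_def intro: piecewise_C1_curve.C1)
next
  case (join a b c)
  have bc: "b < c" using join.hyps(2) by (simp add: C1_curve_def)
  have ab: "a < b \<and> piecewise_C1_curve atlas \<gamma>' a b" using join.prems bc by (intro join.IH) auto
  moreover have "C1_curve atlas \<gamma>' b c"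
    using join.hyps(2) by (rule C1_curve_cong) (use ab join.prems in auto)
  ultimately show ?case using bc by (auto intro: piecewise_C1_curve.join)
qed

text \<open>Chains record the end points and lengths of piecewise \<open>C\<^sup>1\<close> curves, but leave the pieces
  unparametrized.\<close>

inductive chain :: "'a \<Rightarrow> 'a \<Rightarrow> real \<Rightarrow> bool" where
  chain_C1: "C1_curve atlas \<gamma> a b \<Longrightarrow> chain (\<gamma> a) (\<gamma> b) (curve_length atlas g \<gamma> a b)"
| chain_join: "chain x (\<gamma> a) l \<Longrightarrow> C1_curve atlas \<gamma> a b \<Longrightarrow>
    chain x (\<gamma> b) (l + curve_length atlas g \<gamma> a b)"

text \<open>Integrability of the speed is carried through the induction because splitting the length
  at a joint presupposes it.\<close>

lemma piecewise_imp_chain: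
  assumes "piecewise_C1_curve atlas \<gamma> a b"
  shows "a < b \<and> speed atlas g \<gamma> integrable_on {a..b} \<and>
    chain (\<gamma> a) (\<gamma> b) (curve_length atlas g \<gamma> a b)"
  using assms
proof induction
  case (C1 a b)
  then show ?case using C1_curve_length(1) chain_C1 by (auto simp: C1_curve_def)
next
  case (join a b c)
  have bc: "b < c" using join.hyps(2) by (simp add: C1_curve_def)
  have ab: "a < b" "speed atlas g \<gamma> integrable_on {a..b}" using join.IH by auto
  have int: "speed atlas g \<gamma> integrable_on {a..c}"
    by (rule Henstock_Kurzweil_Integration.integrable_combine[where c = b])
      (use ab bc C1_curve_length(1)[OF join.hyps(2)] in simp_all)
  have "curve_length atlas g \<gamma> a c = curve_length atlas g \<gamma> a b + curve_length atlas g \<gamma> b c"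
    unfolding curve_length_def
    using Henstock_Kurzweil_Integration.integral_combine[OF _ _ int, of b] ab bc by simp
  then show ?case using chain_join[OF _ join.hyps(2)] join.IH ab bc int by simp
qed

lemma chain_imp_piecewise:
  assumes "chain x y l"
  shows "\<exists>\<gamma> a b. piecewise_C1_curve atlas \<gamma> a b \<and> \<gamma> a = x \<and> \<gamma> b = y \<and> curve_length atlas g \<gamma> a b = l"
  using assms
proof induction
  case (chain_C1 \<gamma> a b)
  then show ?case using piecewise_C1_curve.C1 by metis
next
  case (chain_join x \<gamma> a l b)
  then obtain \<delta> p q where \<delta>: "piecewise_C1_curve atlas \<delta> p q" "\<delta> p = x" "\<delta> q = \<gamma> a"
    "curve_length atlas g \<delta> p q = l" by blast
  have pq: "p < q" using piecewise_imp_chain[OF \<delta>(1)] by simp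
  have ab: "a < b" using chain_join.hyps(2) by (simp add: C1_curve_def)
  define r where "r = q + b - a"
  define \<gamma>' where "\<gamma>' = \<gamma> \<circ> (\<lambda>t. 1 * t + (a - q))"
  have \<gamma>': "C1_curve atlas \<gamma>' q r" "curve_length atlas g \<gamma>' q r = curve_length atlas g \<gamma> a b"
    unfolding \<gamma>'_def using ab by (intro C1_curve_affine[OF chain_join.hyps(2)]; simp add: r_def)+
  \<comment> \<open>The new piece has been translated to start at \<open>q\<close>, where the curve
    built so far ends; \<open>\<delta> q = \<gamma> a\<close> makes the two definitions compatible
    there.\<close>
  define \<eta> where "\<eta> t = (if t \<le> q then \<delta> t else \<gamma>' t)" for t
  have \<gamma>'q: "\<gamma>' q = \<gamma> a" "\<gamma>' r = \<gamma> b" by (simp_all add: \<gamma>'_def r_def)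
  have pw: "piecewise_C1_curve atlas \<eta> p q"
    using piecewise_C1_curve_cong[OF \<delta>(1), of \<eta>] by (simp add: \<eta>_def)
  have C1: "C1_curve atlas \<eta> q r"
    using \<gamma>'(1) by (rule C1_curve_cong) (use \<gamma>'q \<delta>(3) in \<open>auto simp: \<eta>_def\<close>)
  have l1: "curve_length atlas g \<eta> p q = l"
    unfolding \<delta>(4)[symmetric] unfolding curve_length_def
    by (rule integral_spike[of "{p, q}"])
      (auto simp: \<eta>_def intro!: speed_cong[of "{p<..<q}", symmetric])
  have l2: "curve_length atlas g \<eta> q r = curve_length atlas g \<gamma> a b"
    unfolding \<gamma>'(2)[symmetric] unfolding curve_length_def
    by (rule integral_spike[of "{q, r}"])
      (auto simp: \<eta>_def intro!: speed_cong[of "{q<..<r}", symmetric])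
  have qr: "q < r" using ab by (simp add: r_def)
  have pw': "piecewise_C1_curve atlas \<eta> p r" using pw C1 by (rule piecewise_C1_curve.join)
  have "curve_length atlas g \<eta> p r = l + curve_length atlas g \<gamma> a b"
    unfolding l1[symmetric] l2[symmetric] unfolding curve_length_def
    using Henstock_Kurzweil_Integration.integral_combine[of p q r "speed atlas g \<eta>"]
      piecewise_imp_chain[OF pw'] pq qr by simp
  moreover have "\<eta> p = x" "\<eta> r = \<gamma> b" using pq qr \<delta>(2) \<gamma>'q by (simp_all add: \<eta>_def)
  ultimately show ?case using pw' by blast
qed

text \<open>Reduces the distance to chains, which can be concatenated without
  reparametrizing.\<close>

lemma riemannian_dist_eq: "riemannian_dist atlas g x y = Inf {l. chain x y l}"
proof -
  have "{curve_length atlas g \<gamma> a b |\<gamma> a b. piecewise_C1_curve atlas \<gamma> a b \<and> \<gamma> a = x \<and> \<gamma> b = y}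
    = {l. chain x y l}" (is "?L = ?R")
  proof
    show "?L \<subseteq> ?R" using piecewise_imp_chain by auto
    show "?R \<subseteq> ?L"
    proof
      fix l assume "l \<in> ?R"
      then have "chain x y l" by simp
      from chain_imp_piecewise[OF this] show "l \<in> ?L" by auto
    qed
  qed
  then show ?thesis by (simp add: riemannian_dist_def)
qed

section \<open>Concatenation, reversal and splitting of chains\<close>

lemma chain_nonneg: "chain x y l \<Longrightarrow> 0 \<le> l"
  by (induction rule: chain.induct) (auto simp: C1_curve_length(2))

text \<open>Chains grow at their end, so the induction runs over the second chain, which is why it
  is the first premise.\<close>

lemma chain_trans:
  assumes "chain y z m" "chain x y l"
  shows "chain x z (l + m)"
  using assms
proof induction
  case (chain_C1 \<gamma> a b)
  then show ?case using chain_join by blast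
next
  case (chain_join y \<gamma> a m b)
  then show ?case using chain.chain_join[of x \<gamma> a "l + m" b] by (simp add: add.assoc)
qed

text \<open>Curves live on nondegenerate intervals, so the trivial chain comes from a constant
  curve; it also stands in for degenerate pieces when a chain is split.\<close>

lemma chain_refl: "chain x x 0"
proof -
  let ?\<gamma> = "\<lambda>_::real. x"
  have "C1_curve atlas ?\<gamma> 0 1"
    unfolding C1_curve_def by (auto intro!: exI[of _ "\<lambda>_. 0"] simp: comp_def)
  then have "chain x x (curve_length atlas g ?\<gamma> 0 1)" by (rule chain_C1)
  moreover have "speed atlas g ?\<gamma> = (\<lambda>_. 0)"
  proof
    fix t
    have "\<exists>c. c \<in> atlas \<and> x \<in> chart_dom c" using charts_cover by blast
    from someI_ex[OF this] show "speed atlas g ?\<gamma> t = 0"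
      by (simp add: speed_def Let_def comp_def metric_zero)
  qed
  ultimately show ?thesis by (simp add: curve_length_def)
qed

lemma chain_sym:
  assumes "chain x y l"
  shows "chain y x l"
proof -
  have rev: "chain (\<gamma> b) (\<gamma> a) (curve_length atlas g \<gamma> a b)" if "C1_curve atlas \<gamma> a b" for \<gamma> a b
  proof -
    have "a < b" using that by (simp add: C1_curve_def)
    then have "C1_curve atlas (\<gamma> \<circ> (\<lambda>t. - 1 * t + 0)) (- b) (- a)"
      "curve_length atlas g (\<gamma> \<circ> (\<lambda>t. - 1 * t + 0)) (- b) (- a) = curve_length atlas g \<gamma> a b"
      by (intro C1_curve_affine[OF that]; simp)+
    then show ?thesis using chain_C1[of "\<gamma> \<circ> (\<lambda>t. - 1 * t + 0)" "- b" "- a"] by simp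
  qed
  show ?thesis using assms
  proof induction
    case (chain_join x \<gamma> a l b)
    then show ?case using chain_trans[OF chain_join.IH rev[OF chain_join.hyps(2)]] by (simp add: add.commute)
  qed (rule rev)
qed

text \<open>The length of an initial piece depends continuously on its end point, so the
  intermediate value theorem yields a cut at any prescribed length. This is the source of the length
  space property.\<close>

lemma chain_split:
  assumes "chain x y l" "0 \<le> s" "s \<le> l"
  shows "\<exists>z. chain x z s \<and> chain z y (l - s)"
proof -
  have split: "\<exists>z. chain (\<gamma> a) z s \<and> chain z (\<gamma> b) (curve_length atlas g \<gamma> a b - s)"
    if C1: "C1_curve atlas \<gamma> a b" and s: "0 \<le> s" "s \<le> curve_length atlas g \<gamma> a b" for \<gamma> a b s
  proof -
    have ab: "a < b" using C1 by (simp add: C1_curve_def)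
    have int: "speed atlas g \<gamma> integrable_on {a..b}" using C1 by (rule C1_curve_length(1))
    have "\<exists>t\<ge>a. t \<le> b \<and> curve_length atlas g \<gamma> a t = s"
      unfolding curve_length_def
      using s ab by (intro IVT' indefinite_integral_continuous_1 int) (auto simp: curve_length_def)
    then obtain t where t: "a \<le> t" "t \<le> b" "curve_length atlas g \<gamma> a t = s" by blast
    have l: "curve_length atlas g \<gamma> t b = curve_length atlas g \<gamma> a b - s"
      unfolding t(3)[symmetric] unfolding curve_length_def
      using Henstock_Kurzweil_Integration.integral_combine[OF t(1,2) int] by simp
    have "chain (\<gamma> a) (\<gamma> t) s"
    proof (cases "t = a")
      case True
      then show ?thesis using t(3) chain_refl by (simp add: curve_length_def)
    next
      case False
      then have "C1_curve atlas \<gamma> a t" using t by (intro C1_curve_subinterval[OF C1]) auto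
      then show ?thesis using chain_C1 t(3) by blast
    qed
    moreover have "chain (\<gamma> t) (\<gamma> b) (curve_length atlas g \<gamma> a b - s)"
    proof (cases "t = b")
      case True
      then show ?thesis using t(3) chain_refl by simp
    next
      case False
      then have "C1_curve atlas \<gamma> t b" using t by (intro C1_curve_subinterval[OF C1]) auto
      then show ?thesis using chain_C1 l by metis
    qed
    ultimately show ?thesis by blast
  qed
  show ?thesis using assms
  proof (induction arbitrary: s)
    case (chain_C1 \<gamma> a b)
    then show ?case using split by blast
  next
    case (chain_join x \<gamma> a l b)
    show ?case
    proof (cases "s \<le> l")
      case True
      then obtain z where z: "chain x z s" "chain z (\<gamma> a) (l - s)"
        using chain_join.IH chain_join.prems by blast
      have "chain z (\<gamma> b) (l - s + curve_length atlas g \<gamma> a b)"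
        using z(2) chain_join.hyps(2) by (rule chain.chain_join)
      then show ?thesis using z(1) by (auto simp: algebra_simps)
    next
      case False
      then obtain z where z: "chain (\<gamma> a) z (s - l)"
        "chain z (\<gamma> b) (curve_length atlas g \<gamma> a b - (s - l))"
        using split[OF chain_join.hyps(2), of "s - l"] chain_join.prems by auto
      then show ?thesis using chain_trans[OF z(1) chain_join.hyps(1)] by (auto simp: algebra_simps)
    qed
  qed
qed

end

section \<open>Comparison with the Euclidean distance in charts\<close>

text \<open>Scaling coordinates by \<open>1 / \<rho>\<close> sends a ball of radius
  \<open>k * r\<close> into the Euclidean unit ball, so one finite net of the unit ball serves all
  centres and radii. The mesh \<open>\<eta>\<close> is chosen so that
  \<open>L * (2 * \<eta> * \<rho>) = r\<close>.\<close>

lemma (in length_space) bilipschitz_imp_doubling: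
  fixes \<phi> :: "'a \<Rightarrow> 'e::euclidean_space"
  assumes L: "L > 0"
    and bl: "\<And>y z. y \<in> U \<Longrightarrow> z \<in> U \<Longrightarrow> dist (\<phi> y) (\<phi> z) \<le> L * d y z \<and> d y z \<le> L * dist (\<phi> y) (\<phi> z)"
  shows "doubling U"
  unfolding doubling_def
proof (intro allI impI)
  fix k :: real assume k: "k > 0"
  define \<eta> where "\<eta> = 1 / (2 * k * L\<^sup>2)"
  have \<eta>: "\<eta> > 0" using k L by (simp add: \<eta>_def)
  obtain Q where Q: "finite Q" "cball (0::'e) 1 \<subseteq> (\<Union>q\<in>Q. ball q \<eta>)"
    using compact_cball[of "0::'e" 1] \<eta> by (auto simp: compact_eq_totally_bounded)
  show "\<exists>N. \<forall>x\<in>U. \<forall>r>0. \<exists>P. finite P \<and> card P \<le> N \<and>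
     U \<inter> mcball x (k * r) \<subseteq> (\<Union>p\<in>P. mcball p r)"
  proof (intro exI[of _ "card Q"] ballI allI impI)
    fix x r assume x: "x \<in> U" and r: "(r::real) > 0"
    define \<rho> where "\<rho> = k * r * L"
    have \<rho>: "\<rho> > 0" using k r L by (simp add: \<rho>_def)
    \<comment> \<open>A net point need not come from \<open>U\<close>, so every non-empty cell is
      represented by one of its own points; this costs the factor 2 in
      \<open>2 * \<eta>\<close>.\<close>
    define W where "W q = {z \<in> U \<inter> mcball x (k * r). (1 / \<rho>) *\<^sub>R (\<phi> z - \<phi> x) \<in> ball q \<eta>}" for q
    define h where "h q = (SOME z. z \<in> W q)" for q
    have "U \<inter> mcball x (k * r) \<subseteq> (\<Union>p\<in>h ` Q. mcball p r)"
    proof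
      fix z assume z: "z \<in> U \<inter> mcball x (k * r)"
      have "dist (\<phi> x) (\<phi> z) \<le> L * d x z" using bl x z by blast
      also have "\<dots> \<le> \<rho>" using z L by (simp add: \<rho>_def mult.commute)
      finally have "norm ((1 / \<rho>) *\<^sub>R (\<phi> z - \<phi> x)) \<le> 1"
        using \<rho> by (simp add: dist_norm norm_minus_commute)
      then have "(1 / \<rho>) *\<^sub>R (\<phi> z - \<phi> x) \<in> cball 0 1" by simp
      then obtain q where q: "q \<in> Q" "(1 / \<rho>) *\<^sub>R (\<phi> z - \<phi> x) \<in> ball q \<eta>" using Q(2) by blast
      then have zW: "z \<in> W q" using z by (simp add: W_def)
      then have hW: "h q \<in> W q" unfolding h_def by (rule someI)
      have "dist ((1 / \<rho>) *\<^sub>R (\<phi> z - \<phi> x)) ((1 / \<rho>) *\<^sub>R (\<phi> (h q) - \<phi> x)) < 2 * \<eta>"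
        using zW hW dist_triangle2[of "(1 / \<rho>) *\<^sub>R (\<phi> z - \<phi> x)" "(1 / \<rho>) *\<^sub>R (\<phi> (h q) - \<phi> x)" q]
        by (simp add: W_def dist_commute)
      moreover have "(1 / \<rho>) *\<^sub>R (\<phi> z - \<phi> x) - (1 / \<rho>) *\<^sub>R (\<phi> (h q) - \<phi> x)
          = (1 / \<rho>) *\<^sub>R (\<phi> z - \<phi> (h q))"
        by (simp add: scaleR_diff_right)
      ultimately have "dist (\<phi> z) (\<phi> (h q)) < 2 * \<eta> * \<rho>"
        using \<rho> by (simp add: dist_norm pos_divide_less_eq)
      then have "L * dist (\<phi> z) (\<phi> (h q)) \<le> L * (2 * \<eta> * \<rho>)" using L by simp
      moreover have "L * (2 * \<eta> * \<rho>) = r"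
        using k L by (simp add: \<eta>_def \<rho>_def power2_eq_square)
      moreover have "d z (h q) \<le> L * dist (\<phi> z) (\<phi> (h q))"
        using bl[of z "h q"] zW hW by (simp add: W_def)
      ultimately have "d (h q) z \<le> r" by (simp add: commute)
      then show "z \<in> (\<Union>p\<in>h ` Q. mcball p r)" using q(1) by auto
    qed
    then show "\<exists>P. finite P \<and> card P \<le> card Q \<and> U \<inter> mcball x (k * r) \<subseteq> (\<Union>p\<in>P. mcball p r)"
      using Q(1) by (intro exI[of _ "h ` Q"]) (simp add: card_image_le)
  qed
qed

context riemannian_manifold
begin

text \<open>The coordinate segment has constant velocity \<open>v\<close> in \<open>c\<close>. In
  any other chart its velocity is the image of \<open>v\<close> under the derivative of the
  transition map, which is continuous in the base point, so the segment is a \<open>C1_curve\<close>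
  for the whole atlas.\<close>

lemma chain_line:
  assumes c: "c \<in> atlas" and seg: "closed_segment q q' \<subseteq> chart_ran c"
    and u: "\<And>p v. p \<in> closed_segment q q' \<Longrightarrow> sqrt (g c p v v) \<le> u * norm v"
  shows "\<exists>l\<le>u * dist q q'. chain (chart_inv c q) (chart_inv c q') l"
proof -
  define v where "v = q' - q"
  define p where "p t = q + t *\<^sub>R v" for t
  define \<gamma> where "\<gamma> t = chart_inv c (p t)" for t
  have p_seg: "p t \<in> closed_segment q q'" if "t \<in> {0..1}" for t
    using that unfolding in_segment by (intro exI[of _ t]) (auto simp: p_def v_def algebra_simps)
  then have p_ran: "p t \<in> chart_ran c" if "t \<in> {0..1}" for t using that seg by blast
  have cont_p: "continuous_on S p" for S unfolding p_def by (intro continuous_intros)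
  have cp: "chart_map c (\<gamma> t) = p t" "\<gamma> t \<in> chart_dom c" if "t \<in> {0..1}" for t
    unfolding \<gamma>_def using p_ran[OF that] by (auto simp: chart_map_chart_inv chart_inv_dom)
  have cont: "continuous_on {0..1} \<gamma>"
    unfolding \<gamma>_def using continuous_on_compose2[OF continuous_on_chart_inv[OF c] cont_p] p_ran by blast
  have deriv_c: "((chart_map c \<circ> \<gamma>) has_vector_derivative v) (at t within {0..1})" if "t \<in> {0..1}" for t
  proof (rule has_vector_derivative_transform[OF that])
    show "(p has_vector_derivative v) (at t within {0..1})"
      unfolding p_def by (auto intro!: derivative_eq_intros simp: has_vector_derivative_def)
  qed (simp add: cp)
  have C1: "C1_curve atlas \<gamma> 0 1"
    unfolding C1_curve_def
  proof (intro conjI ballI exI impI)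
    fix d assume d: "d \<in> atlas"
    show "continuous_on {t \<in> {0..1}. \<gamma> t \<in> chart_dom d} (\<lambda>t. frechet_derivative (transition c d) (at (p t)) v)"
    proof (rule continuous_on_compose2[OF continuous_on_transition_derivative[OF c d] cont_p], rule image_subsetI)
      fix t assume t: "t \<in> {t \<in> {0..1}. \<gamma> t \<in> chart_dom d}"
      then have "chart_map c (\<gamma> t) \<in> chart_map c ` (chart_dom c \<inter> chart_dom d)" using cp by blast
      then show "p t \<in> chart_map c ` (chart_dom c \<inter> chart_dom d)" using cp t by simp
    qed
    fix t :: real assume t: "t \<in> {0..1}" "\<gamma> t \<in> chart_dom d"
    show "((chart_map d \<circ> \<gamma>) has_vector_derivative frechet_derivative (transition c d) (at (p t)) v)
        (at t within {0..1})"
      using curve_derivative_transition[OF c d cp(2)[OF t(1)] t(2,1) cont deriv_c[OF t(1)]] cp(1)[OF t(1)]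
      by simp
  qed (use cont in simp_all)
  obtain \<sigma> where \<sigma>: "continuous_on {0..1} \<sigma>" "\<And>c t v. c \<in> atlas \<Longrightarrow> t \<in> {0..1} \<Longrightarrow> \<gamma> t \<in> chart_dom c \<Longrightarrow>
      ((chart_map c \<circ> \<gamma>) has_vector_derivative v) (at t within {0..1}) \<Longrightarrow>
      \<sigma> t = sqrt (g c (chart_map c (\<gamma> t)) v v)"
    "\<And>t. t \<in> {0<..<1} \<Longrightarrow> speed atlas g \<gamma> t = \<sigma> t"
    using C1_curve_speed[OF C1] by metis
  have "\<sigma> t \<le> u * norm v" if "t \<in> {0..1}" for t
    using \<sigma>(2)[OF c that cp(2)[OF that] deriv_c[OF that]] u[OF p_seg[OF that]] cp(1)[OF that] by simp
  then have "integral {0..1} \<sigma> \<le> integral {0..1::real} (\<lambda>_. u * norm v)"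
    using integrable_continuous_real[OF \<sigma>(1)] by (intro integral_le) auto
  also have "\<dots> = u * dist q q'" by (simp add: v_def dist_norm norm_minus_commute)
  finally have "curve_length atlas g \<gamma> 0 1 \<le> u * dist q q'"
    using curve_length_eq_integral[OF \<sigma>(3)] by simp
  moreover have "\<gamma> 0 = chart_inv c q" "\<gamma> 1 = chart_inv c q'" by (simp_all add: \<gamma>_def p_def v_def)
  ultimately show ?thesis using chain_C1[OF C1] by auto
qed

lemma speed_nonneg: "0 \<le> speed atlas g \<gamma> t"
proof -
  have "\<exists>c. c \<in> atlas \<and> \<gamma> t \<in> chart_dom c" using charts_cover by blast
  from someI_ex[OF this] show ?thesis by (simp add: speed_def Let_def metric_nonneg)
qed

text \<open>The coordinate displacement is the integral of the coordinate velocity, whose norm is at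
  most \<open>\<sigma> / l\<close>.\<close>

lemma curve_length_lower_bound:
  assumes c: "c \<in> atlas" and C1: "C1_curve atlas \<gamma> a b" and l: "0 < l"
    and in_K: "\<And>t. t \<in> {a..b} \<Longrightarrow> \<gamma> t \<in> chart_dom c \<and> chart_map c (\<gamma> t) \<in> K"
    and K: "\<And>q v. q \<in> K \<Longrightarrow> l * norm v \<le> sqrt (g c q v v)"
  shows "l * dist (chart_map c (\<gamma> a)) (chart_map c (\<gamma> b)) \<le> curve_length atlas g \<gamma> a b"
proof -
  have ab: "a < b" using C1 by (simp add: C1_curve_def)
  from C1_curve_derivative[OF C1 c]
  obtain D where D: "\<forall>t\<in>{a..b}. \<gamma> t \<in> chart_dom c \<longrightarrow>
      ((chart_map c \<circ> \<gamma>) has_vector_derivative D t) (at t within {a..b})" .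
  obtain \<sigma> where \<sigma>: "continuous_on {a..b} \<sigma>" "\<And>c t v. c \<in> atlas \<Longrightarrow> t \<in> {a..b} \<Longrightarrow> \<gamma> t \<in> chart_dom c \<Longrightarrow>
      ((chart_map c \<circ> \<gamma>) has_vector_derivative v) (at t within {a..b}) \<Longrightarrow>
      \<sigma> t = sqrt (g c (chart_map c (\<gamma> t)) v v)"
    "\<And>t. t \<in> {a<..<b} \<Longrightarrow> speed atlas g \<gamma> t = \<sigma> t"
    using C1_curve_speed[OF C1] by metis
  have "(D has_integral (chart_map c \<circ> \<gamma>) b - (chart_map c \<circ> \<gamma>) a) {a..b}"
    using ab D in_K by (intro fundamental_theorem_of_calculus) (auto simp: comp_def)
  then have D_int: "D integrable_on {a..b}" "integral {a..b} D = chart_map c (\<gamma> b) - chart_map c (\<gamma> a)"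
    by (auto simp: has_integral_integrable_integral)
  have "norm (integral {a..b} D) \<le> integral {a..b} (\<lambda>t. \<sigma> t / l)"
  proof (rule integral_norm_bound_integral[OF D_int(1)])
    show "(\<lambda>t. \<sigma> t / l) integrable_on {a..b}"
      using l by (intro integrable_continuous_real continuous_intros \<sigma>(1)) auto
    fix t assume t: "t \<in> {a..b}"
    have "\<sigma> t = sqrt (g c (chart_map c (\<gamma> t)) (D t) (D t))"
      using \<sigma>(2)[OF c t] in_K[OF t] D t by simp
    then show "norm (D t) \<le> \<sigma> t / l"
      using K[of "chart_map c (\<gamma> t)" "D t"] in_K[OF t] l by (simp add: pos_le_divide_eq mult.commute)
  qed
  also have "\<dots> = curve_length atlas g \<gamma> a b / l"
    using curve_length_eq_integral[OF \<sigma>(3)] by simp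
  finally show ?thesis
    using l by (simp add: D_int(2) dist_norm norm_minus_commute pos_le_divide_eq mult.commute)
qed

text \<open>The coordinate distance from the centre \<open>q\<close>, truncated at
  \<open>\<delta>\<close>. Being defined on the whole manifold, its increments telescope along a
  chain even if the pieces leave and re-enter the chart.\<close>

definition chart_depth :: "('a, 'e) chart \<Rightarrow> 'e \<Rightarrow> real \<Rightarrow> 'a \<Rightarrow> real" where
  "chart_depth c q \<delta> z =
    (if z \<in> chart_dom c \<and> dist q (chart_map c z) < \<delta> then dist q (chart_map c z) else \<delta>)"

lemma chart_depth_le: "chart_depth c q \<delta> z \<le> \<delta>"
  by (simp add: chart_depth_def)

text \<open>If the curve leaves the coordinate ball, only its initial piece up to the first exit counts.
  The curve cannot jump out of the chart, because the closed coordinate ball is closed in the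
  manifold.\<close>

lemma curve_length_ge_chart_depth:
  assumes c: "c \<in> atlas" and C1: "C1_curve atlas \<gamma> a b" and l: "0 < l" and \<delta>: "cball q \<delta> \<subseteq> chart_ran c"
    and K: "\<And>p v. p \<in> cball q \<delta> \<Longrightarrow> l * norm v \<le> sqrt (g c p v v)"
  shows "l * (chart_depth c q \<delta> (\<gamma> b) - chart_depth c q \<delta> (\<gamma> a)) \<le> curve_length atlas g \<gamma> a b"
proof -
  have ab: "a < b" and cont: "continuous_on {a..b} \<gamma>" using C1 by (simp_all add: C1_curve_def)
  define V where "V = chart_dom c \<inter> chart_map c -` ball q \<delta>"
  have V: "open V" unfolding V_def
    using continuous_on_chart_map[OF c] chart_open_dom[OF c] open_ball by (rule continuous_open_preimage)
  have depth_V: "chart_depth c q \<delta> z = dist q (chart_map c z)" if "z \<in> V" for z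
    using that by (simp add: chart_depth_def V_def)
  have depth_notV: "chart_depth c q \<delta> z = \<delta>" if "z \<notin> V" for z
    using that by (auto simp: chart_depth_def V_def)
  show ?thesis
  proof (cases "\<gamma> a \<in> V")
    case False
    \<comment> \<open>Outside \<open>V\<close> the depth is already maximal and cannot
      increase.\<close>
    have "chart_depth c q \<delta> (\<gamma> b) - chart_depth c q \<delta> (\<gamma> a) \<le> 0"
      using depth_notV[OF False] chart_depth_le[of c q \<delta> "\<gamma> b"] by simp
    then have "l * (chart_depth c q \<delta> (\<gamma> b) - chart_depth c q \<delta> (\<gamma> a)) \<le> 0"
      using l by (simp add: mult_le_0_iff)
    then show ?thesis using C1_curve_length(2)[OF C1] by simp
  next
    case aV: True
    define S where "S = {a..b} \<inter> \<gamma> -` (- V)"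
    show ?thesis
    proof (cases "S = {}")
      case True
      then have inV: "\<gamma> t \<in> V" if "t \<in> {a..b}" for t using that by (auto simp: S_def)
      have "l * dist (chart_map c (\<gamma> a)) (chart_map c (\<gamma> b)) \<le> curve_length atlas g \<gamma> a b"
      proof (rule curve_length_lower_bound[OF c C1 l _ K])
        show "\<gamma> t \<in> chart_dom c \<and> chart_map c (\<gamma> t) \<in> cball q \<delta>" if "t \<in> {a..b}" for t
          using inV[OF that] by (simp add: V_def)
      qed
      moreover have "chart_depth c q \<delta> (\<gamma> b) - chart_depth c q \<delta> (\<gamma> a)
          \<le> dist (chart_map c (\<gamma> a)) (chart_map c (\<gamma> b))"
        using depth_V[OF inV[of a]] depth_V[OF inV[of b]] ab
          dist_triangle[of q "chart_map c (\<gamma> b)" "chart_map c (\<gamma> a)"] by simp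
      ultimately show ?thesis using l by (meson mult_left_mono order_trans less_imp_le)
    next
      case False
      have "closed S"
        unfolding S_def using V by (intro continuous_closed_preimage[OF cont]) auto
      moreover have bdd: "bdd_below S" unfolding S_def by (intro bdd_belowI[of _ a]) simp
      ultimately have t0S: "Inf S \<in> S" using False by (intro closed_contains_Inf)
      define t0 where "t0 = Inf S"
      have t0: "a \<le> t0" "t0 \<le> b" "\<gamma> t0 \<notin> V" using t0S by (auto simp: S_def t0_def)
      have at0: "a < t0" using t0 aV by (cases "a = t0") auto
      have inV: "\<gamma> t \<in> V" if "a \<le> t" "t < t0" for t
      proof (rule ccontr)
        assume "\<gamma> t \<notin> V"
        then have "t \<in> S" using that t0 by (simp add: S_def)
        then show False using cInf_lower[OF _ bdd, of t] that by (simp add: t0_def)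
      qed
      \<comment> \<open>A compact subset of a Hausdorff space, hence closed: the exit point
        \<open>\<gamma> t0\<close> is still in the chart domain and, being outside \<open>V\<close>,
        has coordinates at distance exactly \<open>\<delta>\<close> from \<open>q\<close>.\<close>
      define B where "B = chart_inv c ` cball q \<delta>"
      have "compact B" unfolding B_def
        by (intro compact_continuous_image continuous_on_subset[OF continuous_on_chart_inv[OF c] \<delta>]) simp
      then have "closed ({a..b} \<inter> \<gamma> -` B)"
        by (intro continuous_closed_preimage[OF cont] compact_imp_closed) auto
      moreover have "V \<subseteq> B"
        unfolding V_def B_def
      proof
        fix z assume "z \<in> chart_dom c \<inter> chart_map c -` ball q \<delta>"
        then show "z \<in> chart_inv c ` cball q \<delta>"
          using chart_inv_chart_map[OF c, of z] by (intro image_eqI[of _ _ "chart_map c z"]) auto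
      qed
      then have "\<gamma> t \<in> B" if "t \<in> {a..<t0}" for t using inV that by auto
      then have "{a..<t0} \<subseteq> {a..b} \<inter> \<gamma> -` B" using t0(2) by auto
      ultimately have "closure {a..<t0} \<subseteq> {a..b} \<inter> \<gamma> -` B" by (intro closure_minimal)
      then have tB: "\<gamma> t \<in> B" if "t \<in> {a..t0}" for t using that at0 by auto
      have B: "z \<in> chart_dom c \<and> chart_map c z \<in> cball q \<delta>" if "z \<in> B" for z
      proof -
        obtain p where p: "p \<in> cball q \<delta>" "z = chart_inv c p"
          using \<open>z \<in> B\<close> unfolding B_def by (rule imageE)
        then have "p \<in> chart_ran c" using \<delta> by blast
        then show ?thesis using chart_inv_dom[of p c] chart_map_chart_inv[of p c] p by simp
      qed
      have "C1_curve atlas \<gamma> a t0" using at0 t0 by (intro C1_curve_subinterval[OF C1]) auto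
      then have "l * dist (chart_map c (\<gamma> a)) (chart_map c (\<gamma> t0)) \<le> curve_length atlas g \<gamma> a t0"
        by (rule curve_length_lower_bound[OF c _ l B[OF tB] K])
      also have "\<dots> \<le> curve_length atlas g \<gamma> a b"
        unfolding curve_length_def
      proof (rule integral_subset_le)
        show "speed atlas g \<gamma> integrable_on {a..t0}" "speed atlas g \<gamma> integrable_on {a..b}"
          using C1_curve_length(1) \<open>C1_curve atlas \<gamma> a t0\<close> C1 by blast+
      qed (use t0 speed_nonneg in auto)
      finally have "l * dist (chart_map c (\<gamma> a)) (chart_map c (\<gamma> t0)) \<le> curve_length atlas g \<gamma> a b" .
      moreover have "chart_depth c q \<delta> (\<gamma> b) - chart_depth c q \<delta> (\<gamma> a)
          \<le> dist (chart_map c (\<gamma> a)) (chart_map c (\<gamma> t0))"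
      proof -
        have "dist q (chart_map c (\<gamma> t0)) = \<delta>" using B[OF tB[of t0]] t0 at0 by (auto simp: V_def)
        then show ?thesis
          using chart_depth_le[of c q \<delta> "\<gamma> b"] depth_V[OF aV]
            dist_triangle[of q "chart_map c (\<gamma> t0)" "chart_map c (\<gamma> a)"] by simp
      qed
      ultimately show ?thesis using l by (meson mult_left_mono order_trans less_imp_le)
    qed
  qed
qed

lemma chain_ge_chart_depth:
  assumes "chain x y m" and c: "c \<in> atlas" "0 < l" "cball q \<delta> \<subseteq> chart_ran c"
    and K: "\<And>p v. p \<in> cball q \<delta> \<Longrightarrow> l * norm v \<le> sqrt (g c p v v)"
  shows "l * (chart_depth c q \<delta> y - chart_depth c q \<delta> x) \<le> m"
  using assms(1)
proof induction
  case (chain_C1 \<gamma> a b)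
  show ?case by (rule curve_length_ge_chart_depth[OF c(1) chain_C1 c(2,3) K])
next
  case (chain_join x \<gamma> a m b)
  have "l * (chart_depth c q \<delta> (\<gamma> b) - chart_depth c q \<delta> (\<gamma> a)) \<le> curve_length atlas g \<gamma> a b"
    by (rule curve_length_ge_chart_depth[OF c(1) chain_join.hyps(2) c(2,3) K])
  then show ?case using chain_join.IH by (simp add: algebra_simps)
qed

section \<open>Coordinate balls and reachability by chains\<close>

lemma chart_ball:
  obtains c \<delta> l u where "c \<in> atlas" "x \<in> chart_dom c" "0 < \<delta>" "cball (chart_map c x) \<delta> \<subseteq> chart_ran c"
    "0 < l" "0 < u"
    "\<And>q v. q \<in> cball (chart_map c x) \<delta> \<Longrightarrow> l * norm v \<le> sqrt (g c q v v) \<and> sqrt (g c q v v) \<le> u * norm v"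
proof -
  obtain c where c: "c \<in> atlas" "x \<in> chart_dom c" by (rule ex_chart)
  then obtain \<delta> where \<delta>: "0 < \<delta>" "cball (chart_map c x) \<delta> \<subseteq> chart_ran c"
    using chart_open_ran[OF c(1)] open_contains_cball by (metis imageI)
  show thesis
    by (rule metric_bounds[OF c(1) compact_cball \<delta>(2)]) (rule that[OF c \<delta>])
qed

text \<open>Nearby points are joined by coordinate segments, so the points reachable from
  \<open>x\<close> form an open set with open complement. Thus the infimum defining the distance is
  over a non-empty set.\<close>

lemma ex_chain:
  assumes "connected (UNIV :: 'a set)"
  shows "\<exists>l. chain x y l"
proof -
  have nbhd: "\<exists>U. open U \<and> y \<in> U \<and> (\<forall>z\<in>U. \<exists>l. chain y z l)" for y
  proof -
    obtain c \<delta> l u where c: "c \<in> atlas" "y \<in> chart_dom c" "0 < \<delta>" "cball (chart_map c y) \<delta> \<subseteq> chart_ran c"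
      "0 < l" "0 < u"
      "\<And>q v. q \<in> cball (chart_map c y) \<delta> \<Longrightarrow> l * norm v \<le> sqrt (g c q v v) \<and> sqrt (g c q v v) \<le> u * norm v"
      using chart_ball[of y] by metis
    define U where "U = chart_dom c \<inter> chart_map c -` ball (chart_map c y) \<delta>"
    have "open U" unfolding U_def
      using continuous_on_chart_map[OF c(1)] chart_open_dom[OF c(1)] open_ball by (rule continuous_open_preimage)
    moreover have "y \<in> U" using c by (simp add: U_def)
    moreover have "\<exists>l. chain y z l" if z: "z \<in> U" for z
    proof -
      have seg: "closed_segment (chart_map c y) (chart_map c z) \<subseteq> cball (chart_map c y) \<delta>"
        using z c(3) by (intro closed_segment_subset) (auto simp: U_def)
      have "\<exists>l\<le>u * dist (chart_map c y) (chart_map c z).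
          chain (chart_inv c (chart_map c y)) (chart_inv c (chart_map c z)) l"
        using seg c(4,7) by (intro chain_line[OF c(1)]) auto
      then show ?thesis using z c(2) by (auto simp: chart_inv_chart_map[OF c(1)] U_def)
    qed
    ultimately show ?thesis by blast
  qed
  define R where "R = {y. \<exists>l. chain x y l}"
  have "open R"
  proof (rule Topological_Spaces.openI)
    fix y assume y: "y \<in> R"
    obtain U where U: "open U" "y \<in> U" "\<forall>z\<in>U. \<exists>l. chain y z l" using nbhd by blast
    then have "U \<subseteq> R" using y chain_trans unfolding R_def by blast
    then show "\<exists>T. open T \<and> y \<in> T \<and> T \<subseteq> R" using U by blast
  qed
  moreover have "open (- R)"
  proof (rule Topological_Spaces.openI)
    fix y assume y: "y \<in> - R"
    obtain U where U: "open U" "y \<in> U" "\<forall>z\<in>U. \<exists>l. chain y z l" using nbhd by blast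
    have "U \<subseteq> - R"
    proof
      fix z assume "z \<in> U"
      then obtain l where "chain z y l" using U chain_sym by blast
      then show "z \<in> - R" using y chain_trans unfolding R_def by blast
    qed
    then show "\<exists>T. open T \<and> y \<in> T \<and> T \<subseteq> - R" using U by blast
  qed
  moreover have "x \<in> R" using chain_refl by (auto simp: R_def)
  ultimately have "R = UNIV" using assms by (auto simp: connected_clopen closed_def)
  then show ?thesis by (auto simp: R_def)
qed

end

section \<open>The distance as a locally doubling length metric\<close>

locale connected_riemannian_manifold = riemannian_manifold +
  assumes connected: "connected (UNIV :: 'a set)"
begin

abbreviation rdist :: "'a \<Rightarrow> 'a \<Rightarrow> real" where
  "rdist \<equiv> riemannian_dist atlas g"

lemma rdist_le: "chain x y m \<Longrightarrow> rdist x y \<le> m"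
  unfolding riemannian_dist_eq
  by (rule cInf_lower) (auto intro!: bdd_belowI[of _ 0] chain_nonneg)

lemma rdist_ge: "(\<And>m. chain x y m \<Longrightarrow> b \<le> m) \<Longrightarrow> b \<le> rdist x y"
  unfolding riemannian_dist_eq
  by (rule cInf_greatest) (use ex_chain[OF connected, of x y] in auto)

lemma rdist_less_chain: "rdist x y < e \<Longrightarrow> \<exists>m<e. chain x y m"
  using rdist_ge[of x y e] by (meson not_less)

text \<open>The depth vanishes at its centre, which turns the bound on increments into a bound on
  the distance.\<close>

lemma rdist_ge_chart_depth:
  assumes "c \<in> atlas" "0 < l" "0 < \<delta>" "cball (chart_map c x) \<delta> \<subseteq> chart_ran c" "x \<in> chart_dom c"
    and "\<And>p v. p \<in> cball (chart_map c x) \<delta> \<Longrightarrow> l * norm v \<le> sqrt (g c p v v)"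
  shows "l * chart_depth c (chart_map c x) \<delta> y \<le> rdist x y"
proof (rule rdist_ge)
  fix m assume "chain x y m"
  from chain_ge_chart_depth[OF this assms(1,2,4,6)] show "l * chart_depth c (chart_map c x) \<delta> y \<le> m"
    using assms(3,5) by (simp add: chart_depth_def)
qed

sublocale length_space rdist
proof
  fix x y z :: 'a
  show "0 \<le> rdist x y" by (rule rdist_ge) (rule chain_nonneg)
  show "rdist x y = rdist y x"
    unfolding riemannian_dist_eq using chain_sym by (intro arg_cong[of _ _ Inf]) blast
  show "(rdist x y = 0) = (x = y)"
  proof
    assume 0: "rdist x y = 0"
    obtain c \<delta> l u where c: "c \<in> atlas" "x \<in> chart_dom c" "0 < \<delta>" "cball (chart_map c x) \<delta> \<subseteq> chart_ran c"
      "0 < l" "0 < u"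
      "\<And>q v. q \<in> cball (chart_map c x) \<delta> \<Longrightarrow> l * norm v \<le> sqrt (g c q v v) \<and> sqrt (g c q v v) \<le> u * norm v"
      using chart_ball[of x] by metis
    have "l * chart_depth c (chart_map c x) \<delta> y \<le> rdist x y"
      using c by (intro rdist_ge_chart_depth) auto
    then have "chart_depth c (chart_map c x) \<delta> y \<le> 0" using 0 c(5) by (simp add: mult_le_0_iff)
    then have "y \<in> chart_dom c" "chart_map c x = chart_map c y"
      using c(3) unfolding chart_depth_def by (auto split: if_splits)
    then show "x = y" using chart_inv_chart_map[OF c(1)] c(2) by metis
  next
    assume "x = y"
    then show "rdist x y = 0"
      using rdist_le[OF chain_refl] rdist_ge[of x x 0] chain_nonneg by (simp add: order_antisym)
  qed
  show "rdist x z \<le> rdist x y + rdist y z"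
  proof (rule field_le_epsilon)
    fix e :: real assume e: "e > 0"
    obtain m where m: "m < rdist x y + e / 2" "chain x y m"
      using rdist_less_chain[of x y "rdist x y + e / 2"] e by auto
    obtain n where n: "n < rdist y z + e / 2" "chain y z n"
      using rdist_less_chain[of y z "rdist y z + e / 2"] e by auto
    show "rdist x z \<le> rdist x y + rdist y z + e"
      using rdist_le[OF chain_trans[OF n(2) m(2)]] m(1) n(1) by simp
  qed
next
  fix s t :: real and x y assume st: "0 < s" "0 < t" "rdist x y < s + t"
  then obtain m where m: "m < s + t" "chain x y m" using rdist_less_chain by blast
  \<comment> \<open>The chain may be shorter than \<open>s\<close>; with the minimum, the remainder
    then has length 0.\<close>
  obtain z where "chain x z (min s m)" "chain z y (m - min s m)"
    using chain_split[OF m(2), of "min s m"] st chain_nonneg[OF m(2)] by auto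
  then have "rdist x z \<le> min s m" "rdist z y \<le> m - min s m" using rdist_le by blast+
  then show "\<exists>z. rdist x z \<le> s \<and> rdist z y \<le> t" using m(1) st by (intro exI[of _ z]) auto
qed

lemma ex_doubling_mball: "\<exists>R>0. doubling (mball x R)"
proof -
  obtain c \<delta> l u where c: "c \<in> atlas" "x \<in> chart_dom c" "0 < \<delta>" "cball (chart_map c x) \<delta> \<subseteq> chart_ran c"
    "0 < l" "0 < u"
    "\<And>q v. q \<in> cball (chart_map c x) \<delta> \<Longrightarrow> l * norm v \<le> sqrt (g c q v v) \<and> sqrt (g c q v v) \<le> u * norm v"
    using chart_ball[of x] by metis
  let ?\<phi> = "chart_map c"
  \<comment> \<open>Points of this ball have coordinates within \<open>\<delta> / 4\<close> of the
    centre. Two of them are less than \<open>\<delta> / 2\<close> apart, and the coordinate ball of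
    radius \<open>\<delta> / 2\<close> about either stays in the given one, so the depth of one
    measured from the other is not truncated.\<close>
  define R where "R = l * (\<delta> / 4)"
  have R: "R > 0" using c by (simp add: R_def)
  have near: "y \<in> chart_dom c" "dist (?\<phi> x) (?\<phi> y) < \<delta> / 4" if "y \<in> mball x R" for y
  proof -
    have "l * chart_depth c (?\<phi> x) \<delta> y \<le> rdist x y"
      using c by (intro rdist_ge_chart_depth) auto
    also have "\<dots> < l * (\<delta> / 4)" using that by (simp add: R_def)
    finally have "chart_depth c (?\<phi> x) \<delta> y < \<delta> / 4" using c(5) by simp
    then show "y \<in> chart_dom c" "dist (?\<phi> x) (?\<phi> y) < \<delta> / 4"
      using c(3) unfolding chart_depth_def by (auto split: if_splits)
  qed
  have lower: "dist (?\<phi> y) (?\<phi> z) \<le> 1 / l * rdist y z"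
    and upper: "rdist y z \<le> u * dist (?\<phi> y) (?\<phi> z)"
    if y: "y \<in> mball x R" and z: "z \<in> mball x R" for y z
  proof -
    note y' = near[OF y] and z' = near[OF z]
    have sub: "cball (?\<phi> y) (\<delta> / 2) \<subseteq> cball (?\<phi> x) \<delta>"
      using y'(2) c(3) by (intro cball_subset_cball_iff[THEN iffD2]) (simp add: dist_commute)
    have "dist (?\<phi> y) (?\<phi> z) < \<delta> / 2"
      using dist_triangle3[of "?\<phi> y" "?\<phi> z" "?\<phi> x"] y'(2) z'(2) by simp
    then have "chart_depth c (?\<phi> y) (\<delta> / 2) z = dist (?\<phi> y) (?\<phi> z)"
      using z'(1) by (simp add: chart_depth_def)
    moreover have "l * chart_depth c (?\<phi> y) (\<delta> / 2) z \<le> rdist y z"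
      using c sub y'(1) by (intro rdist_ge_chart_depth) auto
    ultimately show "dist (?\<phi> y) (?\<phi> z) \<le> 1 / l * rdist y z"
      using c(5) by (simp add: pos_le_divide_eq mult.commute)
    have seg: "closed_segment (?\<phi> y) (?\<phi> z) \<subseteq> cball (?\<phi> x) \<delta>"
      using y'(2) z'(2) c(3) by (intro closed_segment_subset) auto
    have "\<exists>m\<le>u * dist (?\<phi> y) (?\<phi> z). chain (chart_inv c (?\<phi> y)) (chart_inv c (?\<phi> z)) m"
      using seg c(4,7) by (intro chain_line[OF c(1)]) auto
    then show "rdist y z \<le> u * dist (?\<phi> y) (?\<phi> z)"
      using rdist_le y'(1) z'(1) by (force simp: chart_inv_chart_map[OF c(1)])
  qed
  have "doubling (mball x R)"
  proof (rule bilipschitz_imp_doubling[of "max u (1 / l)" _ ?\<phi>])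
    show "0 < max u (1 / l)" using c(6) by simp
    fix y z assume yz: "y \<in> mball x R" "z \<in> mball x R"
    have "1 / l * rdist y z \<le> max u (1 / l) * rdist y z" by (intro mult_right_mono) auto
    moreover have "u * dist (?\<phi> y) (?\<phi> z) \<le> max u (1 / l) * dist (?\<phi> y) (?\<phi> z)"
      by (intro mult_right_mono) auto
    ultimately show "dist (?\<phi> y) (?\<phi> z) \<le> max u (1 / l) * rdist y z \<and>
        rdist y z \<le> max u (1 / l) * dist (?\<phi> y) (?\<phi> z)"
      using lower[OF yz] upper[OF yz] by linarith
  qed
  then show ?thesis using R by blast
qed

lemma rball_eq: "rball atlas g x r = mcball x r"
  by (simp add: rball_def)

end

text \<open>A finite set of indices with \<open>y \<in> B i\<close> has the size of a partial sum,
  and a uniform bound on finite subsets rules out infinitely many indices. For negative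
  \<open>C\<close> both \<open>ennreal C\<close> and \<open>nat \<lfloor>C\<rfloor>\<close> are
  0.\<close>

lemma infsum_indicator_le:
  fixes B :: "'i \<Rightarrow> 'x set"
  assumes "(\<Sum>\<^sub>\<infinity>i\<in>I. indicator (B i) y) \<le> ennreal C"
  shows "finite {i\<in>I. y \<in> B i} \<and> card {i\<in>I. y \<in> B i} \<le> nat \<lfloor>C\<rfloor>"
proof -
  have bound: "card T \<le> nat \<lfloor>C\<rfloor>" if T: "finite T" "T \<subseteq> {i\<in>I. y \<in> B i}" for T
  proof -
    have "of_nat (card T) = (\<Sum>i\<in>T. indicator (B i) y :: ennreal)"
      using T(2) by (subst sum.cong[of T T _ "\<lambda>_. 1"]) (auto simp: indicator_def)
    also have "\<dots> \<le> (\<Sum>\<^sub>\<infinity>i\<in>I. indicator (B i) y)"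
      using T by (subst nonneg_infsum_complete) (auto intro!: SUP_upper)
    also have "\<dots> \<le> ennreal C" by (rule assms)
    finally have le: "ennreal (real (card T)) \<le> ennreal C" by (simp add: ennreal_of_nat_eq_real_of_nat)
    show ?thesis
    proof (cases "card T = 0")
      case False
      then have "real (card T) \<le> C" using le unfolding ennreal_le_iff2 by auto
      then show ?thesis by (simp add: le_nat_floor)
    qed simp
  qed
  have "finite {i\<in>I. y \<in> B i} \<and> card {i\<in>I. y \<in> B i} \<le> nat \<lfloor>C\<rfloor>"
    by (rule finite_if_finite_subsets_card_bdd) (use bound in blast)
  then show ?thesis .
qed

theorem proposition1:
  fixes atlas :: "('a::{t2_space, second_countable_topology}, 'e::euclidean_space) chart set"
    and g :: "('a, 'e) local_metric"
    and A :: "'a set"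
  assumes "riemannian_manifold atlas g"
    and "connected (UNIV :: 'a set)"
    and "Metric_space.mcomplete UNIV (riemannian_dist atlas g)"
    and "Metric_space.mbounded UNIV (riemannian_dist atlas g) A"
    and "\<exists>C\<^sub>2::real. \<forall>F. ball_collection atlas g A F \<longrightarrow>
      (\<exists>F'\<subseteq>F. \<forall>y.
        (indicator (fst ` F) y :: ennreal)
          \<le> (\<Sum>\<^sub>\<infinity>(x, r)\<in>F'. indicator (rball atlas g x r) y) \<and>
        (\<Sum>\<^sub>\<infinity>(x, r)\<in>F'. indicator (rball atlas g x r) y) \<le> ennreal C\<^sub>2)"
  shows "\<exists>C\<^sub>3::real. \<forall>F. ball_collection atlas g A F \<longrightarrow>
      (\<exists>(m::nat) (G :: nat \<Rightarrow> ('a \<times> real) set).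
        real m \<le> C\<^sub>3 \<and>
        (\<forall>i\<in>{1..m}. G i \<subseteq> F \<and>
          pairwise (\<lambda>(x, r) (y, s). disjnt (rball atlas g x r) (rball atlas g y s)) (G i)) \<and>
        fst ` F \<subseteq> (\<Union>i\<in>{1..m}. \<Union>(x, r)\<in>G i. rball atlas g x r))"
proof -
  interpret connected_riemannian_manifold atlas g
    using assms(1,2) by (simp add: connected_riemannian_manifold_def connected_riemannian_manifold_axioms_def)
  interpret locally_doubling_space rdist
    by unfold_locales (use ex_doubling_mball assms(3) in auto)
  obtain C where C: "\<And>F. ball_collection atlas g A F \<Longrightarrow>
      \<exists>F'\<subseteq>F. \<forall>y. (indicator (fst ` F) y :: ennreal)
          \<le> (\<Sum>\<^sub>\<infinity>(x, r)\<in>F'. indicator (mcball x r) y) \<and>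
        (\<Sum>\<^sub>\<infinity>(x, r)\<in>F'. indicator (mcball x r) y) \<le> ennreal C"
    using assms(5) unfolding rball_eq by metis
  \<comment> \<open>\<open>m\<close> comes from \<open>A\<close> and \<open>C\<close> alone, before
    any family is given, so it can serve as the final constant.\<close>
  obtain m :: nat where m: "\<forall>F. fst ` F \<subseteq> A \<longrightarrow> (\<forall>(x, r)\<in>F. 0 < r) \<longrightarrow>
      (\<forall>y. finite {(x, r)\<in>F. y \<in> mcball x r} \<and> card {(x, r)\<in>F. y \<in> mcball x r} \<le> nat \<lfloor>C\<rfloor>) \<longrightarrow>
      (\<exists>G :: nat \<Rightarrow> ('a \<times> real) set. (\<Union>i\<in>{1..m}. G i) = F \<and>
        (\<forall>i. pairwise (\<lambda>(x, r) (y, s). disjnt (mcball x r) (mcball y s)) (G i)))"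
    using bounded_overlap_imp_disjoint_families[OF assms(4)] ..
  show ?thesis
  proof (intro exI[of _ "real m"] allI impI)
    fix F assume F: "ball_collection atlas g A F"
    obtain F' where F': "F' \<subseteq> F"
      "\<And>y. (indicator (fst ` F) y :: ennreal) \<le> (\<Sum>\<^sub>\<infinity>(x, r)\<in>F'. indicator (mcball x r) y)"
      "\<And>y. (\<Sum>\<^sub>\<infinity>(x, r)\<in>F'. indicator (mcball x r) y) \<le> ennreal C"
      using C[OF F] by blast
    have overlap: "\<forall>y. finite {(x, r)\<in>F'. y \<in> mcball x r} \<and> card {(x, r)\<in>F'. y \<in> mcball x r} \<le> nat \<lfloor>C\<rfloor>"
    proof
      fix y
      have "(\<lambda>(x, r). indicator (mcball x r) y) = (\<lambda>w. indicator (mcball (fst w) (snd w)) y :: ennreal)"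
        by (auto simp: fun_eq_iff)
      then have "finite {w\<in>F'. y \<in> mcball (fst w) (snd w)} \<and>
          card {w\<in>F'. y \<in> mcball (fst w) (snd w)} \<le> nat \<lfloor>C\<rfloor>"
        using F'(3)[of y] by (intro infsum_indicator_le) simp
      moreover have "{w\<in>F'. y \<in> mcball (fst w) (snd w)} = {(x, r)\<in>F'. y \<in> mcball x r}" by auto
      ultimately show "finite {(x, r)\<in>F'. y \<in> mcball x r} \<and> card {(x, r)\<in>F'. y \<in> mcball x r} \<le> nat \<lfloor>C\<rfloor>"
        by simp
    qed
    have F'A: "fst ` F' \<subseteq> A" and pos: "\<forall>(x, r)\<in>F'. 0 < r"
      using F F'(1) unfolding ball_collection_def by fastforce+
    from mp[OF mp[OF mp[OF spec[OF m] F'A] pos] overlap] obtain G :: "nat \<Rightarrow> ('a \<times> real) set" where G: "(\<Union>i\<in>{1..m}. G i) = F'"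
      "\<forall>i. pairwise (\<lambda>(x, r) (y, s). disjnt (mcball x r) (mcball y s)) (G i)" by (elim exE conjE)
    have "fst ` F \<subseteq> (\<Union>i\<in>{1..m}. \<Union>(x, r)\<in>G i. mcball x r)"
    proof
      fix y assume y: "y \<in> fst ` F"
      \<comment> \<open>At a centre the lower bound makes the sum at least 1, so it cannot vanish
        and some ball of \<open>F'\<close> contains that centre.\<close>
      have "\<exists>w\<in>F'. y \<in> mcball (fst w) (snd w)"
      proof (rule ccontr)
        assume "\<not> ?thesis"
        then have "(\<Sum>\<^sub>\<infinity>(x, r)\<in>F'. indicator (mcball x r) y) = (0 :: ennreal)"
          by (intro infsum_0) (auto simp: indicator_def)
        then show False using F'(2)[of y] y by simp
      qed
      then show "y \<in> (\<Union>i\<in>{1..m}. \<Union>(x, r)\<in>G i. mcball x r)"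
        unfolding G(1)[symmetric] by fastforce
    qed
    moreover have "G i \<subseteq> F" if "i \<in> {1..m}" for i using G(1) F'(1) that by blast
    ultimately show "\<exists>(n::nat) (G :: nat \<Rightarrow> ('a \<times> real) set).
        real n \<le> real m \<and>
        (\<forall>i\<in>{1..n}. G i \<subseteq> F \<and>
          pairwise (\<lambda>(x, r) (y, s). disjnt (rball atlas g x r) (rball atlas g y s)) (G i)) \<and>
        fst ` F \<subseteq> (\<Union>i\<in>{1..n}. \<Union>(x, r)\<in>G i. rball atlas g x r)"
      using G(2) unfolding rball_eq by (intro exI[of _ m] exI[of _ G]) simp
  qed
qed

end
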